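(* Let $f(z)=\sum_{k\ge1}a_kz^k$ with $(a_k)_{k\ge1}\in\ell^1$. Then for every positive integer $m$, \[ \sum_{1\le h\le m}(f\otimes\mathscr{M}_1)\big(e^{2i\pi h/m}\big)=0. \]
   Context: $\mu$ is the Möbius function and $\mathscr{M}_1(z)=\sum_{n\ge1}\mu(n)\frac{z^n}{n}$, a series converging (uniformly) on the closed unit disk $|z|\le1$. For power series $A(z)=\sum_{p\ge1}a_pz^p$ and $B(z)=\sum_{q\ge1}b_qz^q$, their Dirichlet product is $A\otimes B(z)=\sum_{p\ge1}a_p\sum_{q\ge1}b_qz^{pq}=\sum_{n\ge1}(a\star b)_nz^n$, where $(a\star b)_n=\sum_{d\mid n}a_db_{n/d}$. Thus $(f\otimes\mathscr{M}_1)(z)=\sum_{k\ge1}a_k\mathscr{M}_1(z^k)$, which for $(a_k)\in\ell^1$ is defined (convergent) for all $|z|\le1$ and is the meaning of $f\otimes\mathscr{M}_1$ on the unit circle. *)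

theory Defs
  imports
    "HOL-Complex_Analysis.Complex_Analysis"
    "HOL-Computational_Algebra.Squarefree"
    "HOL-Number_Theory.Number_Theory"
begin

definition moebius_mu :: "nat \<Rightarrow> int" where
  "moebius_mu n = (if squarefree n then (-1) ^ card (prime_factors n) else 0)"

text \<open>
  A power series $\sum_{n \ge 1} a_n z^n$ without constant term is given by its coefficient
  sequence $a$; only the entries at positive indices matter, hence the shift by \<open>Suc\<close>.
  The sums are ordered series (\<open>suminf\<close>) and not unconditional sums (\<open>infsum\<close>): on the unit
  circle the series of \<open>\<M>\<^sub>1\<close> is in general only conditionally convergent.
\<close>

definition pseries :: "(nat \<Rightarrow> complex) \<Rightarrow> complex \<Rightarrow> complex" where
  "pseries a z = (\<Sum>n. a (Suc n) * z ^ Suc n)"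

definition M1_coeff :: "nat \<Rightarrow> complex" where
  "M1_coeff n = of_int (moebius_mu n) / of_nat n"

definition M1 :: "complex \<Rightarrow> complex" where
  "M1 = pseries M1_coeff"

text \<open>
  The value at \<open>z\<close> of the Dirichlet product of two power series, as the iterated sum
  $\sum_{p \ge 1} a_p \sum_{q \ge 1} b_q z^{pq}$; this is the meaning of the product on the
  unit circle, where the rearranged series $\sum_n (a \star b)_n z^n$ need not converge.
\<close>

definition dirichlet_prod :: "(nat \<Rightarrow> complex) \<Rightarrow> (nat \<Rightarrow> complex) \<Rightarrow> complex \<Rightarrow> complex"
    (infixl \<open>\<otimes>\<^sub>D\<close> 70) where
  "(a \<otimes>\<^sub>D b) z = (\<Sum>p. a (Suc p) * (\<Sum>q. b (Suc q) * z ^ (Suc p * Suc q)))"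

lemma dirichlet_prod_altdef: "(a \<otimes>\<^sub>D b) z = (\<Sum>p. a (Suc p) * pseries b (z ^ Suc p))"
  unfolding dirichlet_prod_def pseries_def by (simp only: power_mult)

lemma dirichlet_prod_M1: "(a \<otimes>\<^sub>D M1_coeff) z = (\<Sum>k. a (Suc k) * M1 (z ^ Suc k))"
  by (simp add: dirichlet_prod_altdef M1_def)

end

theory Submission
  imports Defs
begin

text \<open>
  Summing the series of \<open>M\<^sub>1\<close> over the \<open>k\<close>-th powers of all \<open>m\<close>-th roots of unity leaves
  \<open>m\<close> times the sum of \<open>\<mu>(n)/n\<close> over the multiples \<open>n\<close> of \<open>e = m / gcd(m, k)\<close>. By multiplicativity of \<open>\<mu>\<close>
  this is \<open>\<mu>(e)/e\<close> times the sum of \<open>\<mu>(n)/n\<close> over \<open>n\<close> coprime to \<open>e\<close>, which is 0.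
  The depth lies in the convergence of these conditionally convergent series. Splitting by
  \<open>gcd(n, m)\<close> and expanding in Dirichlet characters reduces it to the series of \<open>\<mu>(n)\<psi>(n)/n\<close>; these
  converge to \<open>1/L(1, \<psi>)\<close> (to 0 if \<open>L\<close> has a pole at 1) by Newman's contour method, because \<open>L(s, \<psi>)\<close> has
  no zero on the line \<open>Re s = 1\<close>.
\<close>

section \<open>Dirichlet series\<close>

text \<open>All functions are given by ordered series, so \<open>suminf\<close> carries meaning only
  once convergence is known; at roots of unity that lies as deep as the prime number theorem in
  progressions. Powers of \<open>m\<close>-th roots of unity stay in a finite set, and a bound of
  \<open>M1\<close> there lets the sum over \<open>h\<close> pass inside the series over
  \<open>k\<close>. Newman's method fits because the coefficients are bounded: it asks of
  \<open>1 / L\<close> only holomorphy near \<open>Re s >= 1\<close>. The continuation of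
  \<open>L\<close> is elementary: a character minus its mean has bounded partial sums, so summation
  by parts reaches \<open>Re s > 0\<close>, and the mean is the residue at 1. The delicate point of
  non-vanishing is \<open>s = 1\<close> for a real character. It is treated like any other
  \<open>1 + i t\<close>: a zero would make a nonnegative series converge at 1/2, and its terms at
  \<open>n\<close> and at \<open>n ^ 2\<close> together would dominate the series of
  \<open>mangoldt n * norm (\<psi> n) / n\<close>, which diverges by the pole of the principal
  series. Characters are built by adjoining one unit at a time to a subgroup. The freedom in each
  step separates residue classes, which yields orthogonality.\<close>

text \<open>The term at \<open>n = 0\<close> vanishes because \<open>0 powr z = 0\<close>.\<close>

definition dser :: "(nat \<Rightarrow> complex) \<Rightarrow> complex \<Rightarrow> complex" where
  "dser a s = (\<Sum>n. a n * of_nat n powr (- s))"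

definition abs_conv_at :: "(nat \<Rightarrow> complex) \<Rightarrow> real \<Rightarrow> bool" where
  "abs_conv_at a \<sigma> \<longleftrightarrow> summable (\<lambda>n. norm (a n) * real n powr (- \<sigma>))"

definition dconv :: "(nat \<Rightarrow> complex) \<Rightarrow> (nat \<Rightarrow> complex) \<Rightarrow> nat \<Rightarrow> complex" where
  "dconv a b n = (\<Sum>d | d dvd n. a d * b (n div d))"

lemma norm_nat_powr: "norm (of_nat n powr s :: complex) = real n powr Re s"
  by (simp add: norm_powr_real_powr)

lemma nat_powr_mult: "of_nat (m * n) powr s = (of_nat m powr s * of_nat n powr s :: complex)"
  by (simp add: powr_times_real_left)

lemma nat_powr_has_field_derivative:
  "((\<lambda>s. of_nat n powr (- s)) has_field_derivative - of_real (ln (real n)) * of_nat n powr (- s))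
     (at s :: complex filter)"
proof (cases "n = 0")
  case False
  then show ?thesis
    by (auto simp: powr_def intro!: derivative_eq_intros)
qed simp

lemma abs_conv_at_mono:
  assumes "abs_conv_at a \<sigma>" "\<sigma> \<le> \<sigma>'"
  shows "abs_conv_at a \<sigma>'"
  unfolding abs_conv_at_def
proof (rule summable_comparison_test'[OF assms(1)[unfolded abs_conv_at_def], of 1])
  fix n :: nat assume "n \<ge> 1"
  then show "norm (norm (a n) * real n powr - \<sigma>') \<le> norm (a n) * real n powr - \<sigma>"
    using assms(2) by (auto intro!: mult_left_mono powr_mono)
qed

lemma abs_conv_at_summable_norm:
  assumes "abs_conv_at a \<sigma>" "\<sigma> \<le> Re s"
  shows "summable (\<lambda>n. norm (a n * of_nat n powr (- s)))"
  using abs_conv_at_mono[OF assms] by (simp add: abs_conv_at_def norm_mult norm_nat_powr)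

lemma dser_sums:
  assumes "abs_conv_at a \<sigma>" "\<sigma> \<le> Re s"
  shows "(\<lambda>n. a n * of_nat n powr (- s)) sums dser a s"
  unfolding dser_def
  by (intro summable_sums summable_norm_cancel[OF abs_conv_at_summable_norm[OF assms]])

text \<open>A logarithm costs only an arbitrarily small shift of the exponent, because
  \<open>ln n\<close> is at most \<open>n powr \<delta> / \<delta>\<close> for every positive
  \<open>\<delta>\<close>.\<close>

lemma abs_conv_at_ln:
  assumes "abs_conv_at a \<sigma>" "\<sigma> < \<sigma>'"
  shows "abs_conv_at (\<lambda>n. a n * of_real (ln (real n))) \<sigma>'"
  unfolding abs_conv_at_def
proof (rule summable_comparison_test'[OF summable_mult[OF assms(1)[unfolded abs_conv_at_def], of "1 / (\<sigma>' - \<sigma>)"], of 1])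
  fix n :: nat assume n: "n \<ge> 1"
  have "ln (real n) \<le> real n powr (\<sigma>' - \<sigma>) / (\<sigma>' - \<sigma>)"
    by (rule ln_powr_bound) (use n assms in auto)
  then have "norm (a n) * (ln (real n) * real n powr - \<sigma>')
      \<le> norm (a n) * (real n powr (\<sigma>' - \<sigma>) / (\<sigma>' - \<sigma>) * real n powr - \<sigma>')"
    by (intro mult_left_mono mult_right_mono) auto
  also have "real n powr (\<sigma>' - \<sigma>) / (\<sigma>' - \<sigma>) * real n powr - \<sigma>' = 1 / (\<sigma>' - \<sigma>) * real n powr - \<sigma>"
    using n by (simp flip: powr_add)
  finally show "norm (norm (a n * of_real (ln (real n))) * real n powr - \<sigma>')
      \<le> 1 / (\<sigma>' - \<sigma>) * (norm (a n) * real n powr - \<sigma>)"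
    using n by (simp add: norm_mult mult_ac)
qed

lemma abs_conv_at_bounded:
  assumes "\<And>n. norm (a n) \<le> C" "1 < \<sigma>"
  shows "abs_conv_at a \<sigma>"
  unfolding abs_conv_at_def
proof (rule summable_comparison_test'[OF summable_mult[where c = C], of "\<lambda>n. real n powr - \<sigma>" 0])
  show "summable (\<lambda>n. real n powr - \<sigma>)"
    using assms(2) by (simp add: summable_real_powr_iff)
  show "norm (norm (a n) * real n powr - \<sigma>) \<le> C * real n powr - \<sigma>" for n
    using assms(1) by (auto intro!: mult_right_mono)
qed

lemma abs_conv_at_norm_le:
  assumes "abs_conv_at a \<sigma>" "\<And>n. norm (b n) \<le> norm (a n)"
  shows "abs_conv_at b \<sigma>"
  unfolding abs_conv_at_def
  by (rule summable_comparison_test'[OF assms(1)[unfolded abs_conv_at_def], of 0])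
     (use assms(2) in \<open>auto intro!: mult_right_mono\<close>)

lemma dser_has_field_derivative:
  assumes a: "abs_conv_at a \<sigma>" and s: "\<sigma> < Re s"
  shows "(dser a has_field_derivative - dser (\<lambda>n. a n * of_real (ln (real n))) s) (at s)"
proof -
  define S where "S = {s. \<sigma> < Re s}"
  have S: "open S" unfolding S_def by (rule open_halfspace_Re_gt)
  have "\<exists>g g'. \<forall>x\<in>S. (\<lambda>n. a n * of_nat n powr (- x)) sums g x \<and>
      (\<lambda>n. a n * (- of_real (ln (real n)) * of_nat n powr (- x))) sums g' x \<and>
      (g has_field_derivative g' x) (at x)"
  proof (rule series_and_derivative_comparison_complex[OF S])
    fix n x
    show "((\<lambda>x. a n * of_nat n powr (- x)) has_field_derivative
        a n * (- of_real (ln (real n)) * of_nat n powr (- x))) (at x)"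
      by (intro DERIV_cmult nat_powr_has_field_derivative)
  next
    fix x assume "x \<in> S"
    \<comment> \<open>The majorant is valid on the whole half-plane, so the radius 1 is
      arbitrary.\<close>
    have "\<forall>y\<in>ball x 1 \<inter> S. norm (a n * of_nat n powr (- y))
        \<le> norm (of_real (norm (a n) * real n powr - \<sigma>) :: complex)" if "n \<ge> 1" for n
      using that by (auto simp: S_def norm_mult norm_nat_powr intro!: mult_left_mono powr_mono)
    then show "\<exists>d h. 0 < d \<and> summable h \<and> range h \<subseteq> \<real>\<^sub>\<ge>\<^sub>0 \<and>
        (\<forall>\<^sub>F n in sequentially. \<forall>y\<in>ball x d \<inter> S. cmod (a n * of_nat n powr - y) \<le> cmod (h n))"
      using a unfolding abs_conv_at_def eventually_sequentially
      by (intro exI[of _ "1::real"] exI[of _ "\<lambda>n. of_real (norm (a n) * real n powr - \<sigma>)"])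
         (auto simp: summable_complex_of_real simp del: of_real_mult intro!: exI[of _ 1])
  qed
  then obtain g g' where g: "\<And>x. x \<in> S \<Longrightarrow> (\<lambda>n. a n * of_nat n powr (- x)) sums g x"
      "\<And>x. x \<in> S \<Longrightarrow> (\<lambda>n. a n * (- of_real (ln (real n)) * of_nat n powr (- x))) sums g' x"
      "\<And>x. x \<in> S \<Longrightarrow> (g has_field_derivative g' x) (at x)"
    by blast
  have "s \<in> S" using s by (simp add: S_def)
  have "g' s = - dser (\<lambda>n. a n * of_real (ln (real n))) s"
    using sums_minus[OF g(2)[OF \<open>s \<in> S\<close>]] by (simp add: dser_def sums_iff mult_ac)
  moreover have "\<forall>x\<in>S. g x = dser a x"
    using g(1) by (auto simp: dser_def sums_iff)
  ultimately show ?thesis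
    using has_field_derivative_transform_within_open[OF g(3)[OF \<open>s \<in> S\<close>] S \<open>s \<in> S\<close>, of "dser a"]
    by simp
qed

lemma dser_mult:
  assumes a: "abs_conv_at a \<sigma>" and b: "abs_conv_at b \<sigma>" and s: "\<sigma> \<le> Re s"
  shows "dser a s * dser b s = dser (dconv a b) s"
proof -
  define u where "u n = a n * of_nat n powr (- s)" for n
  define v where "v n = b n * of_nat n powr (- s)" for n
  \<comment> \<open>Index 0 is removed so that \<open>(m, n)\<close> corresponds bijectively to
    \<open>(m * n, m)\<close>; absolute summability of the double family then permits grouping by
    the product.\<close>
  have hu: "(u has_sum dser a s) {1..}"
    using norm_summable_imp_has_sum[OF abs_conv_at_summable_norm[OF a s] dser_sums[OF a s]]
    by (subst has_sum_cong_neutral[where T = UNIV and g = u]) (auto simp: u_def[abs_def] Suc_le_eq)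
  have hv: "(v has_sum dser b s) {1..}"
    using norm_summable_imp_has_sum[OF abs_conv_at_summable_norm[OF b s] dser_sums[OF b s]]
    by (subst has_sum_cong_neutral[where T = UNIV and g = v]) (auto simp: v_def[abs_def] Suc_le_eq)
  have nu: "(\<lambda>n. norm (u n)) summable_on {1..}" and nv: "(\<lambda>n. norm (v n)) summable_on {1..}"
    using norm_summable_imp_summable_on[of "\<lambda>n. norm (u n)"] norm_summable_imp_summable_on[of "\<lambda>n. norm (v n)"]
      abs_conv_at_summable_norm[OF a s] abs_conv_at_summable_norm[OF b s]
    by (auto simp: u_def[symmetric] v_def[symmetric] intro: summable_on_subset_banach[of _ UNIV])
  have "Infinite_Sum.abs_summable_on (\<lambda>(m, n). u m * v n) ({1..} \<times> {1..})"
    unfolding Infinite_Sum.abs_summable_on_Sigma_iff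
    using nu nv by (auto simp: norm_mult infsum_cmult_right' abs_mult infsum_nonneg intro!: summable_on_cmult_right summable_on_cmult_left)
  note summable = abs_summable_summable[OF this]
  have "((\<lambda>(m, n). u m * v n) has_sum dser a s * dser b s) ({1..} \<times> {1..})"
  proof (rule has_sum_SigmaI[OF _ _ summable])
    show "((\<lambda>m. u m * dser b s) has_sum dser a s * dser b s) {1..}"
      by (rule has_sum_cmult_left[OF hu])
    show "((\<lambda>n. case (m, n) of (m, n) \<Rightarrow> u m * v n) has_sum u m * dser b s) {1..}" for m
      unfolding case_prod_conv by (rule has_sum_cmult_right[OF hv])
  qed
  also have "?this \<longleftrightarrow> ((\<lambda>(N, d). u d * v (N div d)) has_sum dser a s * dser b s)
      (Sigma {1..} (\<lambda>N. {d. d dvd N}))"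
    by (rule has_sum_reindex_bij_witness[where i = "\<lambda>(N, d). (d, N div d)" and j = "\<lambda>(m, n). (m * n, m)"])
       (auto simp: dvd_def)
  finally have "((\<lambda>N. \<Sum>d | d dvd N. u d * v (N div d)) has_sum dser a s * dser b s) {1..}"
    by (rule has_sum_SigmaD) (auto intro!: has_sum_finite)
  also have "?this \<longleftrightarrow> ((\<lambda>N. dconv a b N * of_nat N powr (- s)) has_sum dser a s * dser b s) UNIV"
  proof (rule has_sum_cong_neutral)
    fix N :: nat assume N: "N \<in> {1..} \<inter> UNIV"
    have "u d * v (N div d) = a d * b (N div d) * of_nat N powr (- s)" if "d dvd N" for d
      using nat_powr_mult[of d "N div d" "- s"] that by (simp add: u_def v_def)
    then show "(\<Sum>d | d dvd N. u d * v (N div d)) = dconv a b N * of_nat N powr (- s)"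
      by (simp add: dconv_def sum_distrib_right)
  qed (auto simp: Suc_le_eq)
  finally have "(\<lambda>N. dconv a b N * of_nat N powr (- s)) sums (dser a s * dser b s)"
    by (rule has_sum_imp_sums)
  then show ?thesis
    unfolding dser_def[of "dconv a b"] by (rule sums_unique)
qed

section \<open>Inverse and logarithmic derivative for completely multiplicative coefficients\<close>

text \<open>The class contains the characters, their absolute values and their twists by
  \<open>n powr (- i t)\<close>. For all of them the inverse and the logarithmic derivative of
  \<open>dser g\<close> are again Dirichlet series on \<open>Re s > 1\<close>.\<close>

definition bdd_compl_mult :: "(nat \<Rightarrow> complex) \<Rightarrow> bool" where
  "bdd_compl_mult g \<longleftrightarrow> g 1 = 1 \<and> (\<forall>m n. g (m * n) = g m * g n) \<and> (\<forall>n. norm (g n) \<le> 1)"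

section \<open>Multiplicativity and divisor sums of the Moebius function\<close>

lemma moebius_mu_mult_coprime:
  assumes "coprime m n"
  shows "moebius_mu (m * n) = moebius_mu m * moebius_mu n"
proof (cases "m = 0 \<or> n = 0")
  case True
  then show ?thesis by (auto simp: moebius_mu_def)
next
  case False
  have "prime_factors m \<inter> prime_factors n = {}"
    using coprime_common_divisor[OF assms] not_prime_unit
    by (blast dest: in_prime_factors_imp_prime in_prime_factors_imp_dvd)
  then have "card (prime_factors (m * n)) = card (prime_factors m) + card (prime_factors n)"
    using False by (simp add: prime_factors_product card_Un_disjoint)
  moreover have "squarefree (m * n) \<longleftrightarrow> squarefree m \<and> squarefree n"
    using squarefree_mult_coprime[OF assms] squarefree_multD[of m n] by blast
  ultimately show ?thesis
    by (simp add: moebius_mu_def power_add)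
qed

lemma moebius_mu_prime: "prime p \<Longrightarrow> moebius_mu p = -1"
  by (simp add: moebius_mu_def squarefree_prime prime_prime_factors)

lemma moebius_mu_mult_not_coprime:
  assumes "\<not> coprime m n"
  shows "moebius_mu (m * n) = 0"
proof -
  from assms obtain p where "prime p" "p dvd m" "p dvd n"
    by (metis coprime_iff_gcd_eq_1 gcd_greatest_iff dvd_refl prime_factor_nat)
  then have "p\<^sup>2 dvd m * n" unfolding power2_eq_square by (intro mult_dvd_mono)
  then have "\<not> squarefree (m * n)"
    using \<open>prime p\<close> not_prime_unit unfolding squarefree_def by blast
  then show ?thesis by (simp add: moebius_mu_def)
qed

lemma abs_moebius_mu_le_1: "\<bar>moebius_mu n\<bar> \<le> 1"
  by (simp add: moebius_mu_def power_abs)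

text \<open>Fix a prime \<open>p\<close> dividing \<open>n\<close>. The squarefree divisors come in
  pairs \<open>d\<close>, \<open>p * d\<close> with \<open>d\<close> prime to \<open>p\<close>, and
  the two values of \<open>moebius_mu\<close> cancel.\<close>

lemma sum_moebius_mu_divisors:
  assumes "n > 0"
  shows "(\<Sum>d | d dvd n. moebius_mu d) = (if n = 1 then 1 else 0)"
proof (cases "n = 1")
  case True
  then show ?thesis by (simp add: moebius_mu_def)
next
  case False
  then obtain p where p: "prime p" "p dvd n"
    using prime_factor_nat by blast
  define A where "A = {d. d dvd n \<and> squarefree d \<and> \<not> p dvd d}"
  have fin: "finite {d. d dvd n}" using assms by simp
  then have finA: "finite A" by (rule rev_finite_subset) (auto simp: A_def)
  have coprime: "coprime p d" if "d \<in> A" for d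
    using that p by (auto simp: A_def prime_imp_coprime)
  have *: "{d. d dvd n \<and> squarefree d} = A \<union> (*) p ` A"
  proof (intro equalityI subsetI)
    fix d assume d: "d \<in> {d. d dvd n \<and> squarefree d}"
    show "d \<in> A \<union> (*) p ` A"
    proof (cases "p dvd d")
      case True
      then obtain e where e: "d = p * e" by auto
      have "\<not> p dvd e"
      proof
        assume "p dvd e"
        then have "p\<^sup>2 dvd d" using e by (auto simp: power2_eq_square)
        then show False using d p by (auto simp: squarefree_def dest: not_prime_unit)
      qed
      moreover have "squarefree e" using d squarefree_multD[of p e] e by auto
      moreover have "e dvd n" using d e by (auto dest: dvd_mult_right)
      ultimately show ?thesis using e by (auto simp: A_def)
    qed (use d in \<open>auto simp: A_def\<close>)
  next
    fix d assume "d \<in> A \<union> (*) p ` A"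
    then show "d \<in> {d. d dvd n \<and> squarefree d}"
    proof
      assume "d \<in> (*) p ` A"
      then obtain e where e: "e \<in> A" "d = p * e" by auto
      then show ?thesis
        using coprime[OF e(1)] p
        by (auto simp: A_def intro!: divides_mult squarefree_mult_coprime[OF _ squarefree_prime])
    qed (auto simp: A_def)
  qed
  have "(\<Sum>d | d dvd n. moebius_mu d) = (\<Sum>d\<in>A \<union> (*) p ` A. moebius_mu d)"
    unfolding *[symmetric] using fin by (intro sum.mono_neutral_right) (auto simp: moebius_mu_def)
  also have "\<dots> = (\<Sum>d\<in>A. moebius_mu d) + (\<Sum>d\<in>(*) p ` A. moebius_mu d)"
    using finA by (intro sum.union_disjoint) (auto simp: A_def)
  also have "(\<Sum>d\<in>(*) p ` A. moebius_mu d) = (\<Sum>d\<in>A. moebius_mu (p * d))"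
    using p prime_gt_0_nat[of p] by (subst sum.reindex) (auto simp: inj_on_def)
  also have "\<dots> = (\<Sum>d\<in>A. - moebius_mu d)"
    using coprime p by (intro sum.cong) (auto simp: moebius_mu_mult_coprime moebius_mu_prime)
  finally show ?thesis
    using False by (simp add: sum_negf)
qed

lemma dser_cong:
  assumes "\<And>n. n > 0 \<Longrightarrow> a n = b n"
  shows "dser a s = dser b s"
proof -
  have "a n * of_nat n powr (- s) = b n * of_nat n powr (- s)" for n
    using assms[of n] by (cases "n = 0") auto
  then show ?thesis unfolding dser_def by presburger
qed

lemma dser_delta: "dser (\<lambda>n. if n = 1 then 1 else 0) s = 1"
proof -
  have "(\<lambda>n. (if n = 1 then 1 else 0) * of_nat n powr (- s)) sums
      (\<Sum>n\<in>{1}. (if n = 1 then 1 else 0) * of_nat n powr (- s) :: complex)"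
    by (rule sums_finite) auto
  then show ?thesis unfolding dser_def by (auto simp: sums_iff)
qed

lemma bdd_compl_mult_abs_conv:
  assumes "bdd_compl_mult g" "1 < \<sigma>"
  shows "abs_conv_at g \<sigma>"
  using assms abs_conv_at_bounded[of g 1] by (auto simp: bdd_compl_mult_def)

text \<open>Since \<open>g d * g (n div d) = g n\<close>, a divisor-sum identity carries over to
  twisted coefficients; this is applied to \<open>moebius_mu\<close> and to
  \<open>mangoldt\<close>.\<close>

lemma dconv_compl_mult:
  assumes "bdd_compl_mult g" "n > 0"
  shows "dconv (\<lambda>d. f d * g d) g n = g n * (\<Sum>d | d dvd n. f d)"
proof -
  have "dconv (\<lambda>d. f d * g d) g n = (\<Sum>d | d dvd n. f d * g (d * (n div d)))"
    unfolding dconv_def using assms by (intro sum.cong) (auto simp only: bdd_compl_mult_def mult.assoc)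
  also have "\<dots> = (\<Sum>d | d dvd n. f d * g n)"
    by (intro sum.cong) auto
  finally show ?thesis by (simp add: sum_distrib_left mult.commute)
qed

lemma dser_moebius_mult:
  assumes g: "bdd_compl_mult g" and s: "1 < Re s"
  shows "dser (\<lambda>n. of_int (moebius_mu n) * g n) s * dser g s = 1"
proof -
  obtain \<sigma> where \<sigma>: "1 < \<sigma>" "\<sigma> < Re s" using dense[OF s] by blast
  have "norm (of_int (moebius_mu n) * g n) \<le> norm (g n)" for n
    using abs_moebius_mu_le_1[of n] mult_right_mono[of "\<bar>real_of_int (moebius_mu n)\<bar>" 1 "norm (g n)"]
    by (simp add: norm_mult)
  then have "abs_conv_at (\<lambda>n. of_int (moebius_mu n) * g n) \<sigma>"
    using bdd_compl_mult_abs_conv[OF g \<sigma>(1)] by (rule abs_conv_at_norm_le[rotated])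
  then have "dser (\<lambda>n. of_int (moebius_mu n) * g n) s * dser g s
      = dser (dconv (\<lambda>n. of_int (moebius_mu n) * g n) g) s"
    using bdd_compl_mult_abs_conv[OF g \<sigma>(1)] \<sigma> by (intro dser_mult) auto
  also have "\<dots> = dser (\<lambda>n. if n = 1 then 1 else 0) s"
  proof (rule dser_cong)
    fix n :: nat assume "n > 0"
    have "dconv (\<lambda>n. of_int (moebius_mu n) * g n) g n = g n * of_int (\<Sum>d | d dvd n. moebius_mu d)"
      using dconv_compl_mult[OF g \<open>n > 0\<close>, of "\<lambda>d. of_int (moebius_mu d)"] by simp
    then show "dconv (\<lambda>n. of_int (moebius_mu n) * g n) g n = (if n = 1 then 1 else 0)"
      using g sum_moebius_mu_divisors[OF \<open>n > 0\<close>] by (auto simp: bdd_compl_mult_def)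
  qed
  finally show ?thesis by (simp only: dser_delta)
qed

lemma mangoldt_abs_conv:
  assumes g: "\<And>n. norm (g n) \<le> C" and "1 < \<sigma>"
  shows "abs_conv_at (\<lambda>n. mangoldt n * g n) \<sigma>"
proof -
  obtain \<sigma>' where \<sigma>: "1 < \<sigma>'" "\<sigma>' < \<sigma>" using dense[OF assms(2)] by blast
  have "C \<ge> 0" using order_trans[OF norm_ge_zero g] .
  have "abs_conv_at (\<lambda>n. of_real C * of_real (ln (real n))) \<sigma>"
    using \<open>C \<ge> 0\<close> \<sigma> by (intro abs_conv_at_ln[OF abs_conv_at_bounded[of _ C]]) auto
  then show ?thesis
  proof (rule abs_conv_at_norm_le)
    fix n
    show "norm (mangoldt n * g n) \<le> norm (of_real C * of_real (ln (real n)) :: complex)"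
    proof (cases "n = 0")
      case False
      then show ?thesis
        using mult_mono[OF mangoldt_le[of n] g[of n]] \<open>C \<ge> 0\<close>
        by (simp add: norm_mult abs_mult mult.commute)
    qed simp
  qed
qed

text \<open>The twisted form of the fact that \<open>mangoldt\<close> sums to \<open>ln n\<close>
  over the divisors of \<open>n\<close>; the logarithm of the index is what differentiation
  produces.\<close>

lemma dser_mangoldt_mult:
  assumes g: "bdd_compl_mult g" and s: "1 < Re s"
  shows "dser (\<lambda>n. mangoldt n * g n) s * dser g s = - deriv (dser g) s"
proof -
  obtain \<sigma> where \<sigma>: "1 < \<sigma>" "\<sigma> < Re s" using dense[OF s] by blast
  have "dser (\<lambda>n. mangoldt n * g n) s * dser g s = dser (dconv (\<lambda>n. mangoldt n * g n) g) s"
    using \<sigma> g bdd_compl_mult_abs_conv[OF g \<sigma>(1)]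
    by (intro dser_mult[of _ \<sigma>] mangoldt_abs_conv[of _ 1]) (auto simp: bdd_compl_mult_def)
  also have "\<dots> = dser (\<lambda>n. g n * of_real (ln (real n))) s"
    by (intro dser_cong) (simp add: dconv_compl_mult[OF g] mangoldt_sum)
  also have "\<dots> = - deriv (dser g) s"
    using dser_has_field_derivative[OF bdd_compl_mult_abs_conv[OF g \<sigma>(1)] \<sigma>(2)]
    by (simp add: DERIV_imp_deriv)
  finally show ?thesis .
qed

section \<open>Continuation to the right half-plane\<close>

lemma segment_nat_Suc:
  assumes "z \<in> closed_segment (of_nat n) (of_nat (Suc n) :: complex)"
  obtains t where "z = of_real t" "real n \<le> t" "t \<le> real n + 1"
proof -
  from assms obtain u where u: "0 \<le> u" "u \<le> 1" "z = (1 - u) *\<^sub>R of_nat n + u *\<^sub>R of_nat (Suc n)"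
    by (auto simp: in_segment)
  have "z = of_real (real n + u)"
    using u(3) by (simp add: scaleR_conv_of_real algebra_simps)
  with u(1,2) show ?thesis by (intro that[of "real n + u"]) auto
qed

lemma norm_powr_diff_le:
  assumes n: "n \<ge> 1" and s: "Re s > 0"
    and z: "z \<in> closed_segment (of_nat n) (of_nat (Suc n))"
  shows "norm (of_nat n powr (- s) - z powr (- s)) \<le> norm s * real n powr (- Re s - 1)"
proof -
  let ?S = "closed_segment (of_nat n) (of_nat (Suc n) :: complex)"
  have "norm (of_nat n powr (- s) - z powr (- s))
      \<le> norm s * real n powr (- Re s - 1) * norm (of_nat n - z)"
  proof (rule field_differentiable_bound[of ?S "\<lambda>z. z powr (- s)" "\<lambda>z. - s * z powr (- s - 1)"])
    fix w assume "w \<in> ?S"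
    then obtain t where t: "w = of_real t" "real n \<le> t" "t \<le> real n + 1" by (rule segment_nat_Suc)
    then show "((\<lambda>z. z powr (- s)) has_field_derivative - s * w powr (- s - 1)) (at w within ?S)"
      using n by (intro has_field_derivative_at_within[OF has_field_derivative_powr]) auto
    have "norm (w powr (- s - 1)) = t powr (- Re s - 1)"
      using t by (simp add: norm_powr_real_powr)
    also have "\<dots> \<le> real n powr (- Re s - 1)"
      using t n s by (intro powr_mono2') auto
    finally show "norm (- s * w powr (- s - 1)) \<le> norm s * real n powr (- Re s - 1)"
      by (auto simp: norm_mult intro: mult_left_mono)
  qed (use z in auto)
  moreover have "norm (of_nat n - z) \<le> 1"
  proof -
    obtain t where t: "z = of_real t" "real n \<le> t" "t \<le> real n + 1"
      using z by (rule segment_nat_Suc)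
    have "of_nat n - z = of_real (real n - t)" using t(1) by simp
    then have "norm (of_nat n - z) = \<bar>real n - t\<bar>" by (simp only: norm_of_real)
    then show ?thesis using t by simp
  qed
  ultimately show ?thesis
    by (smt (verit) mult_left_le mult_nonneg_nonneg norm_ge_zero powr_ge_zero)
qed

lemma norm_zeta_term_le:
  assumes n: "n \<ge> 1" and s: "Re s > 0"
  shows "norm ((s - 1) * of_nat n powr (- s) - (of_nat n powr (1 - s) - of_nat (Suc n) powr (1 - s)))
    \<le> norm (s - 1) * norm s * real n powr (- Re s - 1)"
proof -
  let ?S = "closed_segment (of_nat n) (of_nat (Suc n) :: complex)"
  \<comment> \<open>The increment of \<open>?f\<close> over the segment is the expression to be
    bounded, while its derivative contains the difference of \<open>n powr (- s)\<close> and
    \<open>z powr (- s)\<close>, already small by \<open>norm_powr_diff_le\<close>.\<close>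
  let ?f = "\<lambda>z. (s - 1) * of_nat n powr (- s) * z + z powr (1 - s)"
  have "norm (?f (of_nat (Suc n)) - ?f (of_nat n))
      \<le> norm (s - 1) * norm s * real n powr (- Re s - 1) * norm (of_nat (Suc n) - of_nat n :: complex)"
  proof (rule field_differentiable_bound[of ?S ?f "\<lambda>z. (s - 1) * (of_nat n powr (- s) - z powr (- s))"])
    fix w assume w: "w \<in> ?S"
    then obtain t where t: "w = of_real t" "real n \<le> t" "t \<le> real n + 1" by (rule segment_nat_Suc)
    have "(?f has_field_derivative (s - 1) * of_nat n powr (- s) * 1 + (1 - s) * w powr (1 - s - 1)) (at w within ?S)"
      using n t
      by (intro DERIV_add DERIV_cmult DERIV_ident has_field_derivative_at_within[OF has_field_derivative_powr]) auto
    then show "(?f has_field_derivative (s - 1) * (of_nat n powr (- s) - w powr (- s))) (at w within ?S)"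
      by (simp add: algebra_simps)
    show "norm ((s - 1) * (of_nat n powr (- s) - w powr (- s)))
        \<le> norm (s - 1) * norm s * real n powr (- Re s - 1)"
      using norm_powr_diff_le[OF n s w] by (simp add: norm_mult mult_left_mono mult.assoc)
  qed auto
  then show ?thesis by (simp add: algebra_simps)
qed

text \<open>Weierstrass test. On a ball of radius half of \<open>Re x\<close> the exponent stays at
  most \<open>- d - 1\<close>, hence summable; the factor \<open>norm s * (norm s + 1)\<close> is
  wide enough both for the zeta series and for summation by parts.\<close>

lemma holomorphic_series_right_half_plane:
  fixes f :: "nat \<Rightarrow> complex \<Rightarrow> complex"
  assumes f: "\<And>n. f n holomorphic_on {s. Re s > 0}"
    and bound: "\<And>n s. n \<ge> 1 \<Longrightarrow> Re s > 0 \<Longrightarrow>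
      norm (f n s) \<le> C * (norm s * (norm s + 1)) * real n powr (- Re s - 1)"
    and C: "C \<ge> 0"
  obtains g where "g holomorphic_on {s. Re s > 0}" "\<And>s. Re s > 0 \<Longrightarrow> (\<lambda>n. f n s) sums g s"
proof -
  let ?S = "{s. Re s > 0}"
  have S: "open ?S" by (rule open_halfspace_Re_gt)
  have "\<exists>d h. 0 < d \<and> summable h \<and> range h \<subseteq> \<real>\<^sub>\<ge>\<^sub>0 \<and>
      (\<forall>\<^sub>F n in sequentially. \<forall>y\<in>ball x d \<inter> ?S. cmod (f n y) \<le> cmod (h n))" if x: "x \<in> ?S" for x
  proof -
    define d where "d = Re x / 2"
    define K where "K = norm x + d"
    have d: "d > 0" using x by (simp add: d_def)
    define h where "h n = C * (K * (K + 1)) * real n powr (- d - 1)" for n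
    have "summable (\<lambda>n. real n powr (- d - 1))"
      using d summable_real_powr_iff[of "- d - 1"] by simp
    then have "summable h" unfolding h_def by (rule summable_mult)
    have K: "K \<ge> 0" using d by (simp add: K_def)
    have h0: "h n \<ge> 0" for n using K C by (simp add: h_def)
    have "norm (f n y) \<le> h n" if "n \<ge> 1" "y \<in> ball x d \<inter> ?S" for n y
    proof -
      have "norm (x - y) < d" using that by (simp add: dist_norm)
      then have "norm y \<le> K" "Re y \<ge> d"
        using norm_triangle_sub[of y x] abs_Re_le_cmod[of "x - y"]
        by (auto simp: K_def d_def norm_minus_commute)
      have "norm (f n y) \<le> C * (norm y * (norm y + 1)) * real n powr (- Re y - 1)"
        using that by (intro bound) auto
      also have "\<dots> \<le> h n"
        unfolding h_def using \<open>norm y \<le> K\<close> \<open>Re y \<ge> d\<close> C K that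
        by (intro mult_mono powr_mono) auto
      finally show ?thesis .
    qed
    then show ?thesis
      using d \<open>summable h\<close> h0 unfolding eventually_sequentially
      by (intro exI[of _ d] exI[of _ "\<lambda>n. of_real (h n)"])
         (auto simp: summable_complex_of_real intro!: exI[of _ 1])
  qed
  note to_g = this
  obtain g where g: "\<forall>x\<in>?S. (\<lambda>n. f n x) sums g x \<and> g field_differentiable (at x)"
  proof (rule series_differentiable_comparison_complex[where f = f, OF S])
    show "f n field_differentiable at x" if "x \<in> ?S" for n x
      using f[of n] S that by (rule holomorphic_on_imp_differentiable_at)
  qed (use to_g in blast)+
  show ?thesis
  proof (rule that[of g])
    show "g holomorphic_on ?S"
      using g field_differentiable_at_within unfolding holomorphic_on_def by blast
  qed (use g in auto)
qed

lemma nat_powr_tendsto_0: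
  assumes "Re s < 0"
  shows "(\<lambda>n. of_nat n powr s :: complex) \<longlonglongrightarrow> 0"
  using assms by (rule tendsto_neg_powr_complex_of_nat[OF filterlim_ident])

text \<open>Multiplying the zeta series by \<open>s - 1\<close> and subtracting a telescoping series
  leaves \<open>Z\<close>, convergent for \<open>Re s > 0\<close>. As \<open>Z 1 = 1\<close>, the
  difference quotient of \<open>Z\<close> at 1 is the regular part.\<close>

lemma dser_1_continuation:
  obtains E where "E holomorphic_on {s. Re s > 0}"
    "\<And>s. Re s > 1 \<Longrightarrow> dser (\<lambda>_. 1) s = 1 / (s - 1) + E s"
proof -
  let ?S = "{s. Re s > 0}"
  define h :: "nat \<Rightarrow> complex \<Rightarrow> complex" where
    "h n s = (s - 1) * of_nat n powr (- s) - (of_nat n powr (1 - s) - of_nat (Suc n) powr (1 - s))" for n s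
  obtain Z where Z: "Z holomorphic_on ?S" "\<And>s. Re s > 0 \<Longrightarrow> (\<lambda>n. h n s) sums Z s"
  proof (rule holomorphic_series_right_half_plane[of h 1])
    show "h n holomorphic_on ?S" for n unfolding h_def by (intro holomorphic_intros)
    fix n :: nat and s :: complex assume n: "n \<ge> 1" "Re s > 0"
    have "norm (h n s) \<le> norm (s - 1) * norm s * real n powr (- Re s - 1)"
      unfolding h_def by (rule norm_zeta_term_le[OF n])
    also have "\<dots> \<le> 1 * (norm s * (norm s + 1)) * real n powr (- Re s - 1)"
      using norm_triangle_ineq4[of s 1] by (auto simp: mult.commute intro!: mult_right_mono mult_left_mono)
    finally show "norm (h n s) \<le> 1 * (norm s * (norm s + 1)) * real n powr (- Re s - 1)" .
  qed auto
  have "Z s = (s - 1) * dser (\<lambda>_. 1) s" if s: "Re s > 1" for s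
  proof -
    have "(\<lambda>n. (s - 1) * (1 * of_nat n powr (- s))) sums ((s - 1) * dser (\<lambda>_. 1) s)"
      using s by (intro sums_mult dser_sums[OF abs_conv_at_bounded[of _ 1 "Re s"]]) auto
    moreover have "(\<lambda>n. of_nat n powr (1 - s) - of_nat (Suc n) powr (1 - s)) sums (of_nat 0 powr (1 - s) - 0 :: complex)"
      using s by (intro telescope_sums' nat_powr_tendsto_0) auto
    ultimately have "(\<lambda>n. h n s) sums ((s - 1) * dser (\<lambda>_. 1) s - (of_nat 0 powr (1 - s) - 0))"
      unfolding h_def mult_1 by (rule sums_diff)
    then show ?thesis using Z(2)[of s] s sums_unique2 by force
  qed
  moreover have "Z 1 = 1"
  proof -
    \<comment> \<open>Since \<open>0 powr 0 = 0\<close> while positive bases give 1, only the term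
      at \<open>n = 0\<close> survives, with value 1.\<close>
    have "h n 1 = (if n = 0 then 1 else 0)" for n
      by (simp add: h_def del: of_nat_Suc)
    then have "(\<lambda>n. h n 1) sums 1" using sums_single[of 0 "\<lambda>_. 1::complex"] by simp
    then show ?thesis using Z(2)[of 1] sums_unique2 by force
  qed
  moreover have "(\<lambda>s. if s = 1 then deriv Z 1 else (Z s - Z 1) / (s - 1)) holomorphic_on ?S"
    by (rule pole_lemma_open[OF Z(1)]) (rule open_halfspace_Re_gt)
  ultimately show ?thesis
    by (intro that[of "\<lambda>s. if s = 1 then deriv Z 1 else (Z s - Z 1) / (s - 1)"]) (auto simp: field_simps)
qed

text \<open>Summation by parts: the partial sums stay bounded, and the increments of
  \<open>n powr (- s)\<close> have size \<open>n powr (- Re s - 1)\<close>, which is summable for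
  \<open>Re s > 0\<close>.\<close>

lemma dser_bounded_sums_continuation:
  assumes B: "\<And>N. norm (\<Sum>k=1..N. b k) \<le> C" and b: "\<And>n. norm (b n) \<le> D"
  obtains E where "E holomorphic_on {s. Re s > 0}" "\<And>s. Re s > 1 \<Longrightarrow> dser b s = E s"
proof -
  let ?S = "{s. Re s > 0}"
  define B where "B N = (\<Sum>k=1..N. b k)" for N
  define h where "h n s = B n * (of_nat n powr (- s) - of_nat (Suc n) powr (- s))" for n s
  have "C \<ge> 0" using order_trans[OF norm_ge_zero assms(1)] .
  obtain E where E: "E holomorphic_on ?S" "\<And>s. Re s > 0 \<Longrightarrow> (\<lambda>n. h n s) sums E s"
  proof (rule holomorphic_series_right_half_plane[of h C])
    show "h n holomorphic_on ?S" for n unfolding h_def by (intro holomorphic_intros)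
    fix n :: nat and s :: complex assume n: "n \<ge> 1" "Re s > 0"
    have "norm (h n s) \<le> C * (norm s * real n powr (- Re s - 1))"
      unfolding h_def norm_mult
      using assms(1)[of n] \<open>C \<ge> 0\<close> by (intro mult_mono norm_powr_diff_le n) (auto simp: B_def)
    also have "\<dots> \<le> C * ((norm s * (norm s + 1)) * real n powr (- Re s - 1))"
      using \<open>C \<ge> 0\<close> by (intro mult_left_mono mult_right_mono) (auto simp: algebra_simps)
    finally show "norm (h n s) \<le> C * (norm s * (norm s + 1)) * real n powr (- Re s - 1)"
      by (simp only: mult.assoc)
  qed (use \<open>C \<ge> 0\<close> in auto)
  have "dser b s = E s" if s: "Re s > 1" for s
  proof -
    have abel: "(\<Sum>n<Suc N. b n * of_nat n powr (- s)) = (\<Sum>n<N. h n s) + B N * of_nat N powr (- s)" for N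
    proof (induction N)
      case (Suc N)
      have "B (Suc N) = B N + b (Suc N)" by (simp add: B_def)
      with Suc show ?case by (simp add: h_def algebra_simps)
    qed (simp add: B_def)
    have "(\<lambda>N. \<Sum>n<Suc N. b n * of_nat n powr (- s)) \<longlonglongrightarrow> dser b s"
      using dser_sums[OF abs_conv_at_bounded[of b, OF b, of "Re s"], of s] s
      unfolding sums_def by (intro LIMSEQ_Suc) auto
    moreover have "(\<lambda>N. B N * of_nat N powr (- s)) \<longlonglongrightarrow> 0"
    proof (rule Lim_null_comparison)
      show "\<forall>\<^sub>F N in sequentially. norm (B N * of_nat N powr (- s)) \<le> C * norm (of_nat N powr (- s) :: complex)"
        using assms(1) by (auto simp: norm_mult B_def intro!: always_eventually mult_right_mono)
      show "(\<lambda>N. C * norm (of_nat N powr (- s) :: complex)) \<longlonglongrightarrow> 0"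
        using s by (intro tendsto_mult_right_zero tendsto_norm_zero nat_powr_tendsto_0) auto
    qed
    moreover have "(\<lambda>N. \<Sum>n<N. h n s) \<longlonglongrightarrow> E s"
      using E(2)[of s] s by (simp add: sums_def)
    ultimately have "(\<lambda>N. \<Sum>n<Suc N. b n * of_nat n powr (- s)) \<longlonglongrightarrow> E s + 0"
      unfolding abel by (intro tendsto_add)
    with \<open>(\<lambda>N. \<Sum>n<Suc N. b n * of_nat n powr (- s)) \<longlonglongrightarrow> dser b s\<close> show ?thesis
      using LIMSEQ_unique by fastforce
  qed
  with E(1) that show ?thesis by blast
qed

text \<open>Subtracting the mean \<open>A\<close> reduces to bounded partial sums; the removed part
  is \<open>A\<close> times the zeta series and carries the pole.\<close>

lemma dser_continuation:
  assumes sums: "\<And>N. norm ((\<Sum>k=1..N. a k) - A * of_nat N) \<le> C" and a: "\<And>n. norm (a n) \<le> D"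
  obtains E where "E holomorphic_on {s. Re s > 0}"
    "\<And>s. Re s > 1 \<Longrightarrow> dser a s = A / (s - 1) + E s"
proof -
  obtain E1 where E1: "E1 holomorphic_on {s. Re s > 0}"
      "\<And>s. Re s > 1 \<Longrightarrow> dser (\<lambda>_. 1) s = 1 / (s - 1) + E1 s"
    using dser_1_continuation by blast
  obtain E2 where E2: "E2 holomorphic_on {s. Re s > 0}"
      "\<And>s. Re s > 1 \<Longrightarrow> dser (\<lambda>n. a n - A) s = E2 s"
  proof (rule dser_bounded_sums_continuation[of "\<lambda>n. a n - A" C "D + norm A"])
    show "norm (\<Sum>k=1..N. a k - A) \<le> C" for N
      using sums[of N] by (simp add: sum_subtractf mult.commute)
    show "norm (a n - A) \<le> D + norm A" for n
      using a[of n] norm_triangle_ineq4[of "a n" A] by linarith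
  qed blast
  have "dser a s = A / (s - 1) + (A * E1 s + E2 s)" if s: "Re s > 1" for s
  proof -
    have "(\<lambda>n. A * (1 * of_nat n powr (- s)) + (a n - A) * of_nat n powr (- s)) sums
        (A * dser (\<lambda>_. 1) s + dser (\<lambda>n. a n - A) s)"
    proof (intro sums_add sums_mult)
      show "(\<lambda>n. 1 * of_nat n powr (- s)) sums dser (\<lambda>_. 1) s"
        using s by (intro dser_sums[OF abs_conv_at_bounded[of _ 1 "Re s"]]) auto
      have "norm (a n - A) \<le> D + norm A" for n
        using a[of n] norm_triangle_ineq4[of "a n" A] by linarith
      then show "(\<lambda>n. (a n - A) * of_nat n powr (- s)) sums dser (\<lambda>n. a n - A) s"
        using s by (intro dser_sums[OF abs_conv_at_bounded[of _ "D + norm A" "Re s"]]) auto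
    qed
    then have "dser a s = A * dser (\<lambda>_. 1) s + dser (\<lambda>n. a n - A) s"
      by (simp add: dser_def[of a] sums_iff algebra_simps)
    then show ?thesis using E1(2)[OF s] E2(2)[OF s] by (simp add: algebra_simps)
  qed
  moreover have "(\<lambda>s. A * E1 s + E2 s) holomorphic_on {s. Re s > 0}"
    using E1(1) E2(1) by (intro holomorphic_intros)
  ultimately show ?thesis using that by blast
qed

section \<open>The Tauberian theorem of Newman and Ingham\<close>

lemma powr_step_mean_value:
  fixes c :: real
  assumes "n \<ge> 1" "c \<noteq> 0"
  obtains t where "real n < t" "t < real n + 1" "((real n + 1) powr c - real n powr c) / c = t powr (c - 1)"
proof -
  have "\<exists>t>real n. t < real n + 1 \<and> (real n + 1) powr c - real n powr c = (real n + 1 - real n) * (c * t powr (c - 1))"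
    using assms by (intro MVT2) (auto intro!: derivative_eq_intros)
  then show ?thesis using that assms by auto
qed

lemma powr_le_telescope_neg:
  fixes x :: real
  assumes "n \<ge> 1" "x > 0"
  shows "(real n + 1) powr (- 1 - x) \<le> (real n powr - x - (real n + 1) powr - x) / x"
proof -
  obtain t where t: "real n < t" "t < real n + 1"
      "((real n + 1) powr (- x) - real n powr (- x)) / (- x) = t powr (- x - 1)"
    using powr_step_mean_value[of n "- x"] assms by auto
  have "(real n + 1) powr (- 1 - x) \<le> t powr (- 1 - x)"
    using t assms by (intro powr_mono2') auto
  also have "t powr (- 1 - x) = t powr (- x - 1)"
    by (rule arg_cong[of _ _ "\<lambda>c. t powr c"]) simp
  also have "\<dots> = (real n powr - x - (real n + 1) powr - x) / x"
    using t(3) assms(2) by (simp add: field_simps)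
  finally show ?thesis .
qed

text \<open>Comparison with the integral of \<open>t powr (x - 1)\<close>. For \<open>x > 1\<close>
  the integrand increases, so the integral up to \<open>N\<close> controls only the terms before
  \<open>N\<close>; the extra summand is that last term.\<close>

lemma sum_powr_le:
  fixes x :: real
  assumes "N \<ge> 1" "x > 0"
  shows "(\<Sum>n<Suc N. real n powr (x - 1)) \<le> real N powr x / x + real N powr (x - 1)"
proof (cases "x \<le> 1")
  case True
  have "(\<Sum>n<Suc N. real n powr (x - 1)) \<le> real N powr x / x" for N
  proof (induction N)
    case (Suc N)
    have "real (Suc N) powr (x - 1) \<le> (real (Suc N) powr x - real N powr x) / x"
    proof (cases "N = 0")
      case False
      then obtain t where t: "real N < t" "t < real N + 1"
          "((real N + 1) powr x - real N powr x) / x = t powr (x - 1)"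
        using powr_step_mean_value[of N x] assms by auto
      have "(real N + 1) powr (x - 1) \<le> t powr (x - 1)"
        using t False True by (intro powr_mono2') auto
      then show ?thesis using t(3) by (simp add: add.commute)
    qed (use True assms in \<open>auto simp: field_simps\<close>)
    then show ?case using Suc.IH by (simp add: diff_divide_distrib)
  qed simp
  then show ?thesis by (smt (verit) powr_ge_zero)
next
  case False
  have "(\<Sum>n<N. real n powr (x - 1)) \<le> real N powr x / x" for N
  proof (induction N)
    case (Suc N)
    have "real N powr (x - 1) \<le> (real (Suc N) powr x - real N powr x) / x"
    proof (cases "N = 0")
      case False
      then obtain t where t: "real N < t" "t < real N + 1"
          "((real N + 1) powr x - real N powr x) / x = t powr (x - 1)"
        using powr_step_mean_value[of N x] assms by auto
      have "real N powr (x - 1) \<le> t powr (x - 1)"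
        using t \<open>\<not> x \<le> 1\<close> by (intro powr_mono2) auto
      then show ?thesis using t(3) by (simp add: add.commute)
    qed (use assms in auto)
    then show ?case using Suc.IH by (simp add: diff_divide_distrib)
  qed simp
  then show ?thesis by simp
qed

lemma dser_tail_le:
  assumes a: "\<And>n. norm (a n) \<le> C" and s: "Re s > 1" and N: "N \<ge> 1"
  shows "norm (dser a s - (\<Sum>n<Suc N. a n * of_nat n powr (- s)))
    \<le> C * (real N powr (1 - Re s) / (Re s - 1))"
proof -
  define x where "x = Re s - 1"
  have x: "x > 0" using s by (simp add: x_def)
  have C: "C \<ge> 0" using order_trans[OF norm_ge_zero a] .
  define f where "f i = a (i + Suc N) * of_nat (i + Suc N) powr (- s)" for i
  define g where "g i = C * ((real (i + N) powr - x - real (Suc i + N) powr - x) / x)" for i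
  have "(\<lambda>i. real (i + N) powr - x) \<longlonglongrightarrow> 0"
    using x by (intro LIMSEQ_ignore_initial_segment tendsto_neg_powr filterlim_real_sequentially) auto
  then have "(\<lambda>i. real (i + N) powr - x - real (Suc i + N) powr - x) sums (real (0 + N) powr - x - 0)"
    by (rule telescope_sums')
  then have g: "g sums (C * ((real (0 + N) powr - x - 0) / x))"
    unfolding g_def by (intro sums_mult sums_divide)
  have f: "f sums (dser a s - (\<Sum>n<Suc N. a n * of_nat n powr (- s)))"
    unfolding f_def using s
    by (intro sums_split_initial_segment dser_sums[OF abs_conv_at_bounded[OF a, of "Re s"]]) auto
  have "norm (f i) \<le> g i" for i
  proof -
    have "norm (f i) \<le> C * (real (i + N) + 1) powr (- 1 - x)"
      unfolding f_def norm_mult norm_nat_powr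
      using a by (intro mult_mono) (auto simp: x_def C add_ac)
    also have "\<dots> \<le> g i"
      using powr_le_telescope_neg[of "i + N" x] N x C
      unfolding g_def by (intro mult_left_mono) (auto simp: add_ac)
    finally show ?thesis .
  qed
  then have "norm (suminf f) \<le> suminf g"
    using g by (intro norm_suminf_le) (auto simp: sums_iff)
  then show ?thesis
    using f g by (simp add: sums_iff x_def)
qed

text \<open>The odd part of the kernel has an even primitive, so it integrates to 0 over the half circle.\<close>

lemma half_circle_kernel_integral:
  fixes l :: complex
  assumes R: "R > 0"
  shows "((\<lambda>z. (exp (z * l) + exp (- (z * l))) * (1 / z + z / of_real R ^ 2)) has_contour_integral
    2 * of_real pi * \<i>) (part_circlepath 0 R (- pi / 2) (pi / 2))"
proof -
  let ?\<gamma> = "part_circlepath 0 R (- pi / 2) (pi / 2)"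
  \<comment> \<open>\<open>p\<close> is even with \<open>p 0 = 2\<close>, so \<open>q\<close> is the
    integrand without its polar part \<open>2 / z\<close>, entire and odd. The half turn of
    \<open>2 / z\<close> yields the claimed value.\<close>
  define p where "p z = (exp (z * l) + exp (- (z * l))) * (1 + z ^ 2 / of_real R ^ 2)" for z
  define q where "q z = (if z = 0 then deriv p 0 else (p z - p 0) / (z - 0))" for z
  have "p holomorphic_on UNIV"
    using R unfolding p_def by (intro holomorphic_intros) auto
  then have "q holomorphic_on UNIV"
    unfolding q_def by (rule pole_lemma_open) auto
  then obtain Q where Q: "\<And>z. (Q has_field_derivative q z) (at z)"
    using holomorphic_convex_primitive'[of UNIV q] by auto
  have "(p has_field_derivative ((l - l) * 1 + (1 + 1) * 0)) (at 0)"
    using R unfolding p_def by (auto intro!: derivative_eq_intros)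
  then have "deriv p 0 = 0" by (simp add: DERIV_imp_deriv)
  then have odd: "q (- z) = - q z" for z
    by (auto simp: q_def p_def add.commute)
  have "((\<lambda>z. Q z - Q (- z)) has_field_derivative 0) (at z)" for z
  proof -
    have "((\<lambda>z. Q (- z)) has_field_derivative q (- z) * (- 1)) (at z)"
      by (rule DERIV_chain'[OF _ Q]) (auto intro!: derivative_eq_intros)
    from DERIV_diff[OF Q this] show ?thesis by (simp add: odd)
  qed
  then obtain c where "\<And>z. Q z - Q (- z) = c"
    using has_field_derivative_zero_constant[of UNIV "\<lambda>z. Q z - Q (- z)"] by auto
  from this[of "\<i> * R"] this[of 0] have even: "Q (\<i> * R) = Q (- (\<i> * R))" by simp
  have "(q has_contour_integral Q (pathfinish ?\<gamma>) - Q (pathstart ?\<gamma>)) ?\<gamma>"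
    by (rule contour_integral_primitive[where S = UNIV]) (auto intro: Q)
  moreover have "pathfinish ?\<gamma> = \<i> * R" "pathstart ?\<gamma> = - (\<i> * R)"
    unfolding pathfinish_part_circlepath pathstart_part_circlepath cis_conv_exp[symmetric]
    by (simp_all add: complex_eq_iff)
  ultimately have 1: "(q has_contour_integral 0) ?\<gamma>" by (simp only: even diff_self)
  have "((\<lambda>t. 2 / (0 + of_real R * cis t) * R * \<i> * cis t) has_integral
      (pi / 2 - (- pi / 2)) *\<^sub>R (2 * \<i>)) {- pi / 2..pi / 2}"
    using R has_integral_const_real[of "2 * \<i>" "- pi / 2" "pi / 2"] by (simp add: cis_neq_zero)
  then have 2: "((\<lambda>z. 2 / z) has_contour_integral (pi / 2 - (- pi / 2)) *\<^sub>R (2 * \<i>)) ?\<gamma>"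
    by (subst has_contour_integral_part_circlepath_iff) auto
  have "((\<lambda>z. q z + 2 / z) has_contour_integral 0 + (pi / 2 - (- pi / 2)) *\<^sub>R (2 * \<i>)) ?\<gamma>"
    by (rule has_contour_integral_add[OF 1 2])
  moreover have "q z + 2 / z = (exp (z * l) + exp (- (z * l))) * (1 / z + z / of_real R ^ 2)"
    if "z \<in> path_image ?\<gamma>" for z
  proof -
    have "z \<noteq> 0"
      using in_path_image_part_circlepath[OF that] R by auto
    then show ?thesis
      by (simp add: q_def p_def field_simps power2_eq_square)
  qed
  ultimately have "((\<lambda>z. (exp (z * l) + exp (- (z * l))) * (1 / z + z / of_real R ^ 2))
      has_contour_integral 0 + (pi / 2 - (- pi / 2)) *\<^sub>R (2 * \<i>)) ?\<gamma>"
    by (rule has_contour_integral_eq)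
  moreover have "0 + (pi / 2 - (- pi / 2)) *\<^sub>R (2 * \<i>) = 2 * of_real pi * \<i>"
    by (simp add: scaleR_conv_of_real)
  ultimately show ?thesis by (simp only:)
qed

text \<open>This is Cauchy's formula on the full circle, folded: the kernel is odd, so
  \<open>z -> - z\<close> carries the left half to the right half and turns \<open>T (1 + z)\<close>
  into \<open>T (1 - z)\<close>. For a single term it is the preceding integral with
  \<open>l = ln (N / n)\<close>.\<close>

lemma sum_half_circle_integral:
  fixes a :: "nat \<Rightarrow> complex"
  assumes R: "R > 0" and N: "N \<ge> 1"
  defines "T \<equiv> \<lambda>w. \<Sum>n<Suc N. a n * of_nat n powr (- w)"
  shows "((\<lambda>z. (T (1 + z) * of_nat N powr z + T (1 - z) * of_nat N powr (- z)) * (1 / z + z / of_real R ^ 2))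
    has_contour_integral 2 * of_real pi * \<i> * T 1) (part_circlepath 0 R (- pi / 2) (pi / 2))"
proof -
  define l where "l n = (ln (of_nat N) - ln (of_nat n) :: complex)" for n
  define K where "K z = 1 / z + z / of_real R ^ 2" for z :: complex
  have split: "of_nat n powr (- (1 + z)) * of_nat N powr z = of_nat n powr - 1 * exp (z * l n)"
    for n :: nat and z :: complex
    using N by (cases "n = 0") (auto simp: powr_def l_def simp flip: exp_add, auto simp: algebra_simps)
  have "(T (1 + z) * of_nat N powr z + T (1 - z) * of_nat N powr (- z)) * K z =
      (\<Sum>n<Suc N. a n * of_nat n powr - 1 * ((exp (z * l n) + exp (- (z * l n))) * K z))" for z
  proof -
    have "T (1 + z) * of_nat N powr z = (\<Sum>n<Suc N. a n * of_nat n powr - 1 * exp (z * l n))" for z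
      unfolding T_def sum_distrib_right by (intro sum.cong refl) (simp only: mult.assoc split)
    from this[of z] this[of "- z"] show ?thesis
      by (simp add: sum.distrib[symmetric] sum_distrib_right distrib_left distrib_right mult.assoc
               del: sum.lessThan_Suc)
  qed
  moreover have "((\<lambda>z. \<Sum>n<Suc N. a n * of_nat n powr - 1 * ((exp (z * l n) + exp (- (z * l n))) * K z))
      has_contour_integral (\<Sum>n<Suc N. a n * of_nat n powr - 1 * (2 * of_real pi * \<i>)))
      (part_circlepath 0 R (- pi / 2) (pi / 2))"
    unfolding K_def
    by (intro has_contour_integral_sum has_contour_integral_lmul half_circle_kernel_integral R) auto
  moreover have "(\<Sum>n<Suc N. a n * of_nat n powr - 1 * (2 * of_real pi * \<i>)) = 2 * of_real pi * \<i> * T 1"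
    unfolding T_def sum_distrib_left by (intro sum.cong) auto
  ultimately show ?thesis by (simp only: K_def)
qed

section \<open>Bounds on the arc and to the left of the imaginary axis\<close>

lemma half_circle_kernel_eq:
  assumes "norm z = R" "R > 0"
  shows "1 / z + z / of_real R ^ 2 = of_real (2 * Re z / R ^ 2)"
proof -
  have "1 / z = cnj z / of_real R ^ 2"
    using complex_norm_square[of z] assms by (auto simp: field_simps)
  then have "1 / z + z / of_real R ^ 2 = (z + cnj z) / of_real R ^ 2"
    by (simp add: add_divide_distrib add.commute)
  then show ?thesis by (simp add: complex_add_cnj)
qed

text \<open>On the half circle the kernel \<open>1/z + z/R\<^sup>2\<close> equals \<open>2 Re z/R\<^sup>2\<close> and cancels the singularity of the
  tail estimate at \<open>Re z = 0\<close>.\<close>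

lemma newman_half_circle_bound:
  assumes a: "\<And>n. norm (a n) \<le> C" and N: "N \<ge> 1" and R: "R > 0" and z: "norm z = R" "Re z > 0"
    and F: "dser a (1 + z) = F (1 + z)"
  defines "T \<equiv> \<lambda>w. \<Sum>n<Suc N. a n * of_nat n powr (- w)"
  shows "norm ((T (1 + z) * of_nat N powr z + T (1 - z) * of_nat N powr (- z)) * (1 / z + z / of_real R ^ 2)
      - F (1 + z) * of_nat N powr z * (1 / z + z / of_real R ^ 2)) \<le> C * (4 / R ^ 2 + 2 / (R * N))"
proof -
  define x where "x = Re z"
  have x: "x > 0" "x \<le> R" using z abs_Re_le_cmod[of z] by (auto simp: x_def)
  have C: "C \<ge> 0" using order_trans[OF norm_ge_zero a] .
  have "norm (F (1 + z) - T (1 + z)) \<le> C * (real N powr (- x) / x)"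
    using dser_tail_le[of a C "1 + z" N] a z N F by (simp add: T_def x_def)
  then have "norm ((F (1 + z) - T (1 + z)) * of_nat N powr z) \<le> C * (real N powr (- x) / x) * real N powr x"
    unfolding norm_mult norm_nat_powr x_def by (intro mult_right_mono) auto
  also have "\<dots> = C * (1 / x)"
    using N by (simp flip: powr_add)
  finally have 1: "norm ((F (1 + z) - T (1 + z)) * of_nat N powr z) \<le> C * (1 / x)" .
  have "norm (T (1 - z)) \<le> (\<Sum>n<Suc N. C * real n powr (x - 1))"
    unfolding T_def using a by (intro sum_norm_le) (auto simp: norm_mult norm_nat_powr x_def mult_right_mono)
  also have "\<dots> = C * (\<Sum>n<Suc N. real n powr (x - 1))" by (simp only: sum_distrib_left)
  also have "\<dots> \<le> C * (real N powr x / x + real N powr (x - 1))"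
    by (intro mult_left_mono sum_powr_le) (use C N x in auto)
  finally have "norm (T (1 - z) * of_nat N powr (- z))
      \<le> C * (real N powr x / x + real N powr (x - 1)) * real N powr (- x)"
    unfolding norm_mult norm_nat_powr by (simp add: x_def mult_right_mono)
  also have "\<dots> = C * (1 / x + 1 / N)"
    using N x by (simp add: powr_diff powr_minus_divide field_simps)
  finally have 2: "norm (T (1 - z) * of_nat N powr (- z)) \<le> C * (1 / x + 1 / N)" .
  have kernel: "norm (of_real (2 * Re z / R ^ 2) :: complex) = 2 * x / R ^ 2"
    unfolding norm_of_real using x by (simp add: x_def)
  \<comment> \<open>Removing the \<open>F\<close> part leaves \<open>T (1 - z)\<close> and the tail
    \<open>F (1 + z) - T (1 + z)\<close>. Scaled by powers of \<open>N\<close> they are at most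
    \<open>C * (1 / x + 1 / N)\<close> and \<open>C / x\<close>, and the kernel contributes
    \<open>2 * x / R ^ 2\<close>.\<close>
  have "norm ((T (1 + z) * of_nat N powr z + T (1 - z) * of_nat N powr (- z)) * (1 / z + z / of_real R ^ 2)
      - F (1 + z) * of_nat N powr z * (1 / z + z / of_real R ^ 2))
      = norm (T (1 - z) * of_nat N powr (- z) - (F (1 + z) - T (1 + z)) * of_nat N powr z) * (2 * x / R ^ 2)"
    unfolding half_circle_kernel_eq[OF z(1) R] left_diff_distrib[symmetric] norm_mult kernel
    by (simp add: algebra_simps)
  also have "\<dots> \<le> (C * (1 / x + 1 / N) + C * (1 / x)) * (2 * x / R ^ 2)"
    using 1 2 x by (intro mult_right_mono norm_triangle_le_diff) auto
  also have "\<dots> = C * (4 / R ^ 2 + 2 * (x / R) / (R * N))"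
    using x N R by (simp add: field_simps power2_eq_square)
  also have "\<dots> \<le> C * (4 / R ^ 2 + 2 * 1 / (R * N))"
    using x N R C by (intro mult_left_mono add_left_mono divide_right_mono) auto
  finally show ?thesis by simp
qed

lemma norm_diff_le_on_segment:
  fixes \<Phi> :: "complex \<Rightarrow> complex"
  assumes "\<And>z. z \<in> closed_segment u v \<Longrightarrow> (\<Phi> has_field_derivative \<phi> z) (at z)"
    and "\<And>z. z \<in> closed_segment u v \<Longrightarrow> norm (\<phi> z) \<le> B"
  shows "norm (\<Phi> u - \<Phi> v) \<le> B * norm (u - v)"
  by (rule field_differentiable_bound[of "closed_segment u v" \<Phi> \<phi>])
     (use assms in \<open>auto intro: has_field_derivative_at_within\<close>)

lemma in_cbox_complex: "z \<in> cbox u v \<longleftrightarrow> Re u \<le> Re z \<and> Re z \<le> Re v \<and> Im u \<le> Im z \<and> Im z \<le> Im v"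
  by (auto simp: cbox_def Basis_complex_def inner_complex_def)

text \<open>The primitive \<open>\<Phi>\<close> takes the place of contour deformation: its
  increment is measured along three sides of a rectangle. The horizontal sides are short and have
  \<open>N powr Re z <= 1\<close>; the vertical side carries the factor
  \<open>N powr (- \<delta>)\<close>.\<close>

lemma newman_left_bound:
  assumes box: "cbox (Complex (- \<delta>) (- R)) (Complex 0 R) \<subseteq> S"
    and M: "\<And>z. z \<in> cbox (Complex (- \<delta>) (- R)) (Complex 0 R) \<Longrightarrow> norm (H z) \<le> M"
    and \<Phi>: "\<And>z. z \<in> S \<Longrightarrow> (\<Phi> has_field_derivative H z * of_nat N powr z) (at z)"
    and R: "R > 0" and N: "N \<ge> 1" and \<delta>: "\<delta> > 0"
  shows "norm (\<Phi> (Complex 0 R) - \<Phi> (Complex 0 (- R))) \<le> 2 * M * \<delta> + 2 * R * M * real N powr (- \<delta>)"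
proof -
  let ?B = "cbox (Complex (- \<delta>) (- R)) (Complex 0 R)"
  have "Complex 0 0 \<in> ?B" using R \<delta> by (simp add: in_cbox_complex)
  then have M0: "M \<ge> 0" using order_trans[OF norm_ge_zero M] by blast
  have convex: "closed_segment u v \<subseteq> ?B" if "u \<in> ?B" "v \<in> ?B" for u v
    using that by (simp add: closed_segment_subset)
  have corners: "Complex 0 R \<in> ?B" "Complex 0 (- R) \<in> ?B" "Complex (- \<delta>) R \<in> ?B" "Complex (- \<delta>) (- R) \<in> ?B"
    using R \<delta> by (auto simp: in_cbox_complex)
  have hor: "norm (\<Phi> u - \<Phi> v) \<le> M * norm (u - v)" if "u \<in> ?B" "v \<in> ?B" for u v
  proof (rule norm_diff_le_on_segment[where \<phi> = "\<lambda>z. H z * of_nat N powr z"])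
    fix z assume "z \<in> closed_segment u v"
    then have z: "z \<in> ?B" using convex[OF that] by blast
    then show "(\<Phi> has_field_derivative H z * of_nat N powr z) (at z)" using \<Phi> box by blast
    have "real N powr Re z \<le> 1" using z N powr_mono[of "Re z" 0 "real N"] by (simp add: in_cbox_complex)
    then show "norm (H z * of_nat N powr z) \<le> M"
      using mult_mono[OF M[OF z], of "real N powr Re z" 1] M0 by (simp add: norm_mult norm_nat_powr)
  qed
  have ver: "norm (\<Phi> (Complex (- \<delta>) R) - \<Phi> (Complex (- \<delta>) (- R)))
      \<le> M * real N powr (- \<delta>) * norm (Complex (- \<delta>) R - Complex (- \<delta>) (- R))"
  proof (rule norm_diff_le_on_segment[where \<phi> = "\<lambda>z. H z * of_nat N powr z"])
    fix z assume z': "z \<in> closed_segment (Complex (- \<delta>) R) (Complex (- \<delta>) (- R))"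
    then have z: "z \<in> ?B" using convex corners by blast
    then show "(\<Phi> has_field_derivative H z * of_nat N powr z) (at z)" using \<Phi> box by blast
    obtain u where "z = (1 - u) *\<^sub>R Complex (- \<delta>) R + u *\<^sub>R Complex (- \<delta>) (- R)"
      using z' by (auto simp: in_segment)
    then have "Re z = (1 - u) * - \<delta> + u * - \<delta>" by simp
    then have "Re z = - \<delta>" by (simp add: algebra_simps)
    then show "norm (H z * of_nat N powr z) \<le> M * real N powr (- \<delta>)"
      using M[OF z] by (simp add: norm_mult norm_nat_powr mult_right_mono)
  qed
  have norms: "norm (Complex 0 R - Complex (- \<delta>) R) = \<delta>" "norm (Complex (- \<delta>) (- R) - Complex 0 (- R)) = \<delta>"
      "norm (Complex (- \<delta>) R - Complex (- \<delta>) (- R)) = 2 * R"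
    using R \<delta> by (auto simp: complex_diff cmod_def real_sqrt_mult)
  have "norm (\<Phi> (Complex 0 R) - \<Phi> (Complex 0 (- R)))
      \<le> norm (\<Phi> (Complex 0 R) - \<Phi> (Complex (- \<delta>) R))
        + norm (\<Phi> (Complex (- \<delta>) R) - \<Phi> (Complex (- \<delta>) (- R)))
        + norm (\<Phi> (Complex (- \<delta>) (- R)) - \<Phi> (Complex 0 (- R)))"
    using norm_triangle_ineq[of "\<Phi> (Complex 0 R) - \<Phi> (Complex (- \<delta>) R)" "\<Phi> (Complex (- \<delta>) R) - \<Phi> (Complex (- \<delta>) (- R))"]
      norm_triangle_ineq[of "\<Phi> (Complex 0 R) - \<Phi> (Complex (- \<delta>) (- R))" "\<Phi> (Complex (- \<delta>) (- R)) - \<Phi> (Complex 0 (- R))"]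
    by simp
  then show ?thesis
    using hor[OF corners(1,3)] hor[OF corners(4,2)] ver unfolding norms by (simp add: algebra_simps)
qed

text \<open>Compactness of a segment of the line \<open>Re s = 1\<close> gives a uniform width to
  its left. The segment reaches height \<open>R + 1\<close> because the width is capped at
  1.\<close>

lemma strip_in_open:
  assumes V: "open V" "{s. Re s \<ge> 1} \<subseteq> V"
  obtains d where "d > 0" "\<And>z. - d < Re z \<Longrightarrow> \<bar>Im z\<bar> < R + d \<Longrightarrow> 1 + z \<in> V"
proof -
  define K where "K = cbox (Complex 1 (- R - 1)) (Complex 1 (R + 1))"
  have "compact K" "K \<subseteq> V" using V(2) by (auto simp: K_def in_cbox_complex)
  then obtain e where e: "e > 0" "(\<Union>x\<in>K. ball x e) \<subseteq> V"
    using compact_subset_open_imp_ball_epsilon_subset V(1) by metis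
  show ?thesis
  proof (rule that[of "min e 1"])
    fix z assume z: "- min e 1 < Re z" "\<bar>Im z\<bar> < R + min e 1"
    show "1 + z \<in> V"
    proof (cases "Re z \<ge> 0")
      case True
      then show ?thesis using V(2) by auto
    next
      case False
      have "Complex 1 (Im z) - (1 + z) = of_real (- Re z)" by (simp add: complex_eq_iff)
      then have "dist (Complex 1 (Im z)) (1 + z) = \<bar>- Re z\<bar>" by (simp only: dist_norm norm_of_real)
      then have "1 + z \<in> ball (Complex 1 (Im z)) e" using z False by simp
      moreover have "Complex 1 (Im z) \<in> K" using z by (auto simp: K_def in_cbox_complex)
      ultimately show ?thesis using e(2) by blast
    qed
  qed (use e in auto)
qed

text \<open>\<open>F 1 = 0\<close> cancels the pole of the kernel at \<open>z = 0\<close>, so the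
  \<open>F\<close> integral can be moved across the imaginary axis, where the powers of
  \<open>N\<close> make it small.\<close>

lemma newman_tauberian_0:
  assumes a: "\<And>n. norm (a n) \<le> C" and V: "open V" "{s. Re s \<ge> 1} \<subseteq> V"
    and F: "F holomorphic_on V" "\<And>s. Re s > 1 \<Longrightarrow> dser a s = F s" and F1: "F 1 = 0"
  shows "(\<lambda>n. a n / of_nat n) sums 0"
proof -
  define T where "T N w = (\<Sum>n<Suc N. a n * of_nat n powr (- w))" for N :: nat and w
  have C: "C \<ge> 0" using order_trans[OF norm_ge_zero a] .
  have bound: "\<exists>N0. \<forall>N\<ge>N0. norm (T N 1) < \<epsilon>" if \<epsilon>: "\<epsilon> > 0" for \<epsilon>
  proof -
    \<comment> \<open>This makes the limit \<open>4 * pi * C / R\<close> of the arc term smaller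
      than \<open>\<epsilon>\<close>. Together with \<open>2 * M * \<delta> <= \<epsilon>\<close>
      the total stays below \<open>2 * pi * \<epsilon>\<close>.\<close>
    define R where "R = 4 * pi * C / \<epsilon> + 1"
    have R: "R > 0" using \<epsilon> C by (simp add: R_def add_nonneg_pos)
    obtain d where d: "d > 0" "\<And>z. - d < Re z \<Longrightarrow> \<bar>Im z\<bar> < R + d \<Longrightarrow> 1 + z \<in> V"
      using strip_in_open[OF V, of R] by blast
    define S where "S = {z. - d < Re z} \<inter> {z. - (R + d) < Im z} \<inter> {z. Im z < R + d}"
    have S: "open S" "convex S" unfolding S_def
      by (auto intro!: open_Int open_halfspace_Re_gt open_halfspace_Im_gt open_halfspace_Im_lt
            convex_Int convex_halfspace_Re_gt convex_halfspace_Im_gt convex_halfspace_Im_lt)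
    define G where "G z = (if z = 0 then deriv (\<lambda>z. F (1 + z)) 0 else (F (1 + z) - F (1 + 0)) / (z - 0))" for z
    have "(\<lambda>z. F (1 + z)) holomorphic_on S"
      using d(2) by (intro holomorphic_on_compose_gen[of "\<lambda>z. 1 + z" S F V, unfolded o_def])
         (auto intro!: holomorphic_intros F simp: S_def)
    then have "G holomorphic_on S"
      unfolding G_def by (rule pole_lemma_open) (rule S)
    define H where "H z = G z * (1 + z ^ 2 / of_real R ^ 2)" for z
    have H: "H holomorphic_on S"
      unfolding H_def using R by (intro holomorphic_intros \<open>G holomorphic_on S\<close>) auto
    have H_eq: "H z = F (1 + z) * (1 / z + z / of_real R ^ 2)" if "z \<noteq> 0" for z
      using that R by (simp add: H_def G_def F1 field_simps power2_eq_square)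
    define B where "B \<delta> = cbox (Complex (- \<delta>) (- R)) (Complex 0 R)" for \<delta>
    have B: "B \<delta> \<subseteq> S" if "\<delta> < d" for \<delta>
      using that d(1) by (auto simp: B_def S_def in_cbox_complex)
    have "compact (H ` B (d / 2))"
      using d(1) by (intro compact_continuous_image continuous_on_subset[OF holomorphic_on_imp_continuous_on[OF H]] B)
        (auto simp: B_def)
    then obtain M where M: "M > 0" "\<And>z. z \<in> B (d / 2) \<Longrightarrow> norm (H z) \<le> M"
      using compact_imp_bounded[of "H ` B (d / 2)"] bounded_pos[of "H ` B (d / 2)"] by auto
    \<comment> \<open>\<open>M\<close> was taken on the fixed box of width \<open>d / 2\<close>
      because \<open>\<delta>\<close> depends on it; the smaller box inherits the bound.\<close>
    define \<delta> where "\<delta> = min (d / 2) (\<epsilon> / (2 * M))"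
    have \<delta>: "\<delta> > 0" "\<delta> < d" "\<delta> \<le> d / 2" "2 * M * \<delta> \<le> \<epsilon>"
      using d(1) M(1) \<epsilon> by (auto simp: \<delta>_def min_def field_simps)
    have M': "norm (H z) \<le> M" if "z \<in> B \<delta>" for z
      using that \<delta> by (intro M(2)) (auto simp: B_def in_cbox_complex)
    have main: "2 * pi * norm (T N 1) \<le> C * (4 / R ^ 2 + 2 / (R * N)) * R * pi + (2 * M * \<delta> + 2 * R * M * real N powr (- \<delta>))"
      if N: "N \<ge> 1" for N
    proof -
      let ?\<gamma> = "part_circlepath 0 R (- pi / 2) (pi / 2)"
      have image: "path_image ?\<gamma> \<subseteq> {z. norm z = R \<and> Re z \<ge> 0}"
      proof
        fix z assume "z \<in> path_image ?\<gamma>"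
        then obtain x where x: "z = 0 + of_real R * cis x" "x \<in> closed_segment (- pi / 2) (pi / 2)"
          unfolding path_image_part_circlepath' by (rule imageE)
        then have "- (pi / 2) \<le> x" "x \<le> pi / 2" by (auto simp: closed_segment_eq_real_ivl)
        then show "z \<in> {z. norm z = R \<and> Re z \<ge> 0}"
          using x(1) R cos_ge_zero[of x] by (simp add: norm_mult)
      qed
      have endpoints: "pathfinish ?\<gamma> = Complex 0 R" "pathstart ?\<gamma> = Complex 0 (- R)"
        unfolding pathfinish_part_circlepath pathstart_part_circlepath cis_conv_exp[symmetric]
        by (simp_all add: complex_eq_iff)
      have "(\<lambda>z. H z * of_nat N powr z) holomorphic_on S" by (intro holomorphic_intros H)
      then obtain \<Phi> where \<Phi>: "\<And>z. z \<in> S \<Longrightarrow> (\<Phi> has_field_derivative H z * of_nat N powr z) (at z within S)"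
        using holomorphic_convex_primitive'[OF S(2,1)] by metis
      define X where "X = \<Phi> (Complex 0 R) - \<Phi> (Complex 0 (- R))"
      have "((\<lambda>z. H z * of_nat N powr z) has_contour_integral X) ?\<gamma>"
        unfolding X_def endpoints[symmetric]
      proof (rule contour_integral_primitive[OF \<Phi>])
        have "z \<in> S" if "norm z = R" "Re z \<ge> 0" for z
          using that d(1) abs_Im_le_cmod[of z] by (auto simp: S_def)
        then show "path_image ?\<gamma> \<subseteq> S" using image by auto
      qed auto
      then have "((\<lambda>z. F (1 + z) * of_nat N powr z * (1 / z + z / of_real R ^ 2)) has_contour_integral X) ?\<gamma>"
      proof (rule has_contour_integral_eq)
        fix z assume "z \<in> path_image ?\<gamma>"
        then have "z \<noteq> 0" using image R by auto
        then show "H z * of_nat N powr z = F (1 + z) * of_nat N powr z * (1 / z + z / of_real R ^ 2)"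
          by (simp add: H_eq)
      qed
      from has_contour_integral_diff[OF sum_half_circle_integral[OF R N, of a, folded T_def] this]
      have "norm (2 * of_real pi * \<i> * T N 1 - X) \<le> C * (4 / R ^ 2 + 2 / (R * N)) * R * (pi / 2 - (- pi / 2))"
      proof (rule has_contour_integral_bound_part_circlepath_strong[where k = "{Complex 0 R, Complex 0 (- R)}"])
        fix z assume z: "z \<in> path_image ?\<gamma> - {Complex 0 R, Complex 0 (- R)}"
        then have nz: "norm z = R" "Re z \<ge> 0" using image by auto
        have "Re z \<noteq> 0"
        proof
          assume "Re z = 0"
          then have "\<bar>Im z\<bar> = R" using nz(1) by (simp add: cmod_def)
          with \<open>Re z = 0\<close> z show False by (auto simp: complex_eq_iff abs_if split: if_splits)
        qed
        then have "Re z > 0" using nz by simp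
        then show "norm ((T N (1 + z) * of_nat N powr z + T N (1 - z) * of_nat N powr - z) * (1 / z + z / (of_real R)\<^sup>2)
            - F (1 + z) * of_nat N powr z * (1 / z + z / (of_real R)\<^sup>2)) \<le> C * (4 / R\<^sup>2 + 2 / (R * real N))"
          unfolding T_def using nz by (intro newman_half_circle_bound[OF a N R] F) auto
      qed (use R C in auto)
      moreover have "norm X \<le> 2 * M * \<delta> + 2 * R * M * real N powr (- \<delta>)"
        unfolding X_def
      proof (rule newman_left_bound[OF _ _ _ R N \<delta>(1)])
        show "(\<Phi> has_field_derivative H z * of_nat N powr z) (at z)" if "z \<in> S" for z
          using \<Phi>[OF that] by (simp add: at_within_open[OF that S(1)])
      qed (use B[OF \<delta>(2)] M' in \<open>auto simp: B_def\<close>)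
      moreover have "norm (2 * of_real pi * \<i> * T N 1) = 2 * pi * norm (T N 1)"
        by (simp add: norm_mult)
      ultimately show ?thesis
        using norm_triangle_sub[of "2 * of_real pi * \<i> * T N 1" X] by simp
    qed
    have "(\<lambda>N. C * (4 / R ^ 2 + 2 / (R * real N)) * R * pi + (2 * M * \<delta> + 2 * R * M * real N powr (- \<delta>)))
        \<longlonglongrightarrow> C * (4 / R ^ 2 + 0) * R * pi + (2 * M * \<delta> + 2 * R * M * 0)"
      using R \<delta>(1)
      by (intro tendsto_intros tendsto_neg_powr filterlim_real_sequentially real_tendsto_divide_at_top
            filterlim_tendsto_pos_mult_at_top[OF tendsto_const]) auto
    moreover have "C * (4 / R ^ 2 + 0) * R * pi + (2 * M * \<delta> + 2 * R * M * 0) < 2 * pi * \<epsilon>"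
    proof -
      have "4 * pi * C < R * \<epsilon>" using \<epsilon> by (simp add: R_def field_simps)
      then have "C * (4 / R ^ 2 + 0) * R * pi < \<epsilon>"
        using R by (simp add: field_simps power2_eq_square)
      moreover have "2 * \<epsilon> \<le> 2 * pi * \<epsilon>" using pi_gt3 \<epsilon> by simp
      ultimately show ?thesis using \<delta>(4) by linarith
    qed
    ultimately have "\<forall>\<^sub>F N in sequentially. C * (4 / R ^ 2 + 2 / (R * real N)) * R * pi
        + (2 * M * \<delta> + 2 * R * M * real N powr (- \<delta>)) < 2 * pi * \<epsilon>"
      by (rule order_tendstoD)
    with eventually_ge_at_top[of 1] have "\<forall>\<^sub>F N in sequentially. norm (T N 1) < \<epsilon>"
    proof eventually_elim
      case (elim N)
      then have "2 * pi * norm (T N 1) < 2 * pi * \<epsilon>" using main[of N] by linarith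
      then show ?case by simp
    qed
    then show ?thesis by (simp add: eventually_sequentially)
  qed
  then have "(\<lambda>N. T N 1) \<longlonglongrightarrow> 0"
    unfolding LIMSEQ_iff by simp
  moreover have "T N 1 = (\<Sum>n<Suc N. a n / of_nat n)" for N
    unfolding T_def by (intro sum.cong) (auto simp: powr_minus_divide)
  ultimately show ?thesis
    unfolding sums_def by (subst filterlim_sequentially_Suc[symmetric]) simp
qed

text \<open>Lowering the coefficient at \<open>n = 1\<close> by \<open>F 1\<close> lowers the
  function by the constant \<open>F 1\<close>, which reduces to a vanishing value at 1.\<close>

theorem newman_tauberian:
  assumes a: "\<And>n. norm (a n) \<le> C" and V: "open V" "{s. Re s \<ge> 1} \<subseteq> V"
    and F: "F holomorphic_on V" "\<And>s. Re s > 1 \<Longrightarrow> dser a s = F s"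
  shows "(\<lambda>n. a n / of_nat n) sums F 1"
proof -
  define \<delta> where "\<delta> n = (if n = 1 then F 1 else 0)" for n :: nat
  have \<delta>: "(\<lambda>n. \<delta> n * of_nat n powr (- s)) sums F 1" for s
    using sums_single[of 1 "\<lambda>n. \<delta> n * of_nat n powr (- s)"]
    by (simp add: \<delta>_def if_distrib[of "\<lambda>x. x * _"] cong: if_cong)
  have "(\<lambda>n. (a n - \<delta> n) / of_nat n) sums 0"
  proof (rule newman_tauberian_0[OF _ V])
    show "norm (a n - \<delta> n) \<le> C + norm (F 1)" for n
    proof -
      have "norm (\<delta> n) \<le> norm (F 1)" by (simp add: \<delta>_def)
      then show ?thesis using a[of n] norm_triangle_ineq4[of "a n" "\<delta> n"] by linarith
    qed
    show "(\<lambda>s. F s - F 1) holomorphic_on V" by (intro holomorphic_intros F)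
    show "dser (\<lambda>n. a n - \<delta> n) s = F s - F 1" if "Re s > 1" for s
    proof -
      have "(\<lambda>n. a n * of_nat n powr (- s)) sums F s"
        using dser_sums[OF abs_conv_at_bounded[of a C "Re s"], of s] a that F(2) by simp
      from sums_diff[OF this \<delta>[of s]] show ?thesis
        by (simp add: dser_def sums_iff left_diff_distrib)
    qed
  qed simp
  moreover have "(\<lambda>n. \<delta> n / of_nat n) sums F 1"
    using sums_single[of 1 "\<lambda>n. \<delta> n / of_nat n"]
    by (simp add: \<delta>_def if_distrib[of "\<lambda>x. x / _"] cong: if_cong)
  ultimately have "(\<lambda>n. (a n - \<delta> n) / of_nat n + \<delta> n / of_nat n) sums (0 + F 1)"
    by (rule sums_add)
  then show ?thesis by (simp add: diff_divide_distrib)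
qed

section \<open>Non-vanishing on the line \<open>Re s = 1\<close>\<close>

lemma nat_powr_of_real: "(of_nat n :: complex) powr (- of_real \<sigma>) = of_real (real n powr (- \<sigma>))"
  using powr_of_real[of "real n" "- \<sigma>"] by simp

lemma dser_of_real_sums:
  assumes "abs_conv_at (\<lambda>n. of_real (d n)) \<sigma>"
  shows "\<exists>S. (\<lambda>n. d n * real n powr (- \<sigma>)) sums S \<and> dser (\<lambda>n. of_real (d n)) (of_real \<sigma>) = of_real S"
proof -
  have "summable (\<lambda>n. norm (d n * real n powr (- \<sigma>)))"
    using assms by (simp add: abs_conv_at_def abs_mult)
  then have *: "summable (\<lambda>n. d n * real n powr (- \<sigma>))" by (rule summable_norm_cancel)
  have "(\<lambda>n. of_real (d n * real n powr (- \<sigma>)) :: complex) sums of_real (\<Sum>n. d n * real n powr (- \<sigma>))"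
    by (rule sums_of_real[OF summable_sums[OF *]])
  then have "dser (\<lambda>n. of_real (d n)) (of_real \<sigma>) = of_real (\<Sum>n. d n * real n powr (- \<sigma>))"
    by (simp add: dser_def nat_powr_of_real sums_iff)
  with summable_sums[OF *] show ?thesis by blast
qed

text \<open>Landau: Taylor expansion of \<open>K\<close> at \<open>\<sigma>\<^sub>0 + r/4\<close> reaches beyond \<open>\<sigma>\<^sub>0\<close>; as all terms are nonnegative, the
  resulting double series may be summed in the other order.\<close>

lemma landau_singularity:
  fixes c :: "nat \<Rightarrow> real"
  assumes c: "\<And>n. c n \<ge> 0" and conv: "\<And>\<sigma>. \<sigma> > \<sigma>0 \<Longrightarrow> abs_conv_at (\<lambda>n. of_real (c n)) \<sigma>"
    and K: "K holomorphic_on ball (of_real \<sigma>0) r" and r: "r > 0"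
    and K_eq: "\<And>s. s \<in> ball (of_real \<sigma>0) r \<Longrightarrow> Re s > \<sigma>0 \<Longrightarrow> K s = dser (\<lambda>n. of_real (c n)) s"
  shows "\<exists>\<sigma><\<sigma>0. abs_conv_at (\<lambda>n. of_real (c n)) \<sigma>"
proof -
  \<comment> \<open>\<open>w\<close> has distance \<open>3 * r / 8\<close> from \<open>b\<close>,
    less than the radius \<open>r / 2\<close> of a ball around \<open>b\<close> that still lies in
    the given ball.\<close>
  define b w where "b = \<sigma>0 + r / 4" and "w = \<sigma>0 - r / 8"
  define U where "U = ball (of_real \<sigma>0 :: complex) r \<inter> {s. Re s > \<sigma>0}"
  have U: "open U" unfolding U_def by (intro open_Int open_ball open_halfspace_Re_gt)
  have conv_ln: "abs_conv_at (\<lambda>n. of_real (c n * ln (real n) ^ k)) \<sigma>" if "\<sigma> > \<sigma>0" for k \<sigma>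
    using that
  proof (induction k arbitrary: \<sigma>)
    case (Suc k)
    obtain \<sigma>' where "\<sigma>0 < \<sigma>'" "\<sigma>' < \<sigma>" using dense[OF Suc.prems] by blast
    from abs_conv_at_ln[OF Suc.IH[OF this(1)] this(2)] show ?case by (simp add: mult_ac)
  qed (use conv in simp)
  have higher_deriv: "(deriv ^^ k) K s = (- 1) ^ k * dser (\<lambda>n. of_real (c n * ln (real n) ^ k)) s"
    if "s \<in> U" for k s
    using that
  proof (induction k arbitrary: s)
    case 0
    then show ?case by (simp add: U_def K_eq)
  next
    case (Suc k)
    obtain \<sigma>' where \<sigma>': "\<sigma>0 < \<sigma>'" "\<sigma>' < Re s" using dense[of \<sigma>0 "Re s"] Suc.prems by (auto simp: U_def)
    have "((\<lambda>s. (- 1) ^ k * dser (\<lambda>n. of_real (c n * ln (real n) ^ k)) s) has_field_derivative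
        (- 1) ^ k * - dser (\<lambda>n. of_real (c n * ln (real n) ^ k) * of_real (ln (real n))) s) (at s)"
      by (intro DERIV_cmult dser_has_field_derivative[OF conv_ln[OF \<sigma>'(1)] \<sigma>'(2)])
    from has_field_derivative_transform_within_open[OF this U Suc.prems Suc.IH[symmetric]]
    show ?case by (simp add: DERIV_imp_deriv mult_ac)
  qed
  have "ball (of_real b) (r / 2) \<subseteq> ball (of_real \<sigma>0 :: complex) r"
    using r by (simp add: ball_subset_ball_iff b_def dist_norm flip: of_real_diff)
  then have "K holomorphic_on ball (of_real b) (r / 2)" by (rule holomorphic_on_subset[OF K])
  moreover have "of_real w \<in> ball (of_real b :: complex) (r / 2)"
    unfolding mem_ball dist_of_real using r by (simp add: dist_real_def w_def b_def)
  ultimately have taylor: "(\<lambda>k. (deriv ^^ k) K (of_real b) / fact k * (of_real w - of_real b) ^ k) sums K (of_real w)"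
    by (rule holomorphic_power_series)
  have bU: "of_real b \<in> U"
    using r by (simp add: U_def b_def dist_norm flip: of_real_diff)
  \<comment> \<open>The \<open>k\<close>-th term in the expansion of \<open>n powr (- w)\<close> as
    \<open>n powr (- b) * exp ((b - w) * ln n)\<close>, weighted by \<open>c n\<close>. The signs of
    the \<open>k\<close>-th derivative and of \<open>(w - b) ^ k\<close> cancel.\<close>
  define f where "f k n = c n * real n powr (- b) * (((b - w) * ln (real n)) ^ k / fact k)" for k n
  have f0: "f k n \<ge> 0" for k n
    using c r by (cases "n = 0") (auto simp: f_def b_def w_def)
  have "\<exists>S. f k sums S \<and> (deriv ^^ k) K (of_real b) / fact k * (of_real w - of_real b) ^ k = of_real S" for k
  proof -
    obtain S where S: "(\<lambda>n. c n * ln (real n) ^ k * real n powr (- b)) sums S"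
        "dser (\<lambda>n. of_real (c n * ln (real n) ^ k)) (of_real b) = of_real S"
      using dser_of_real_sums[OF conv_ln[of b k]] r by (auto simp: b_def)
    have "(of_real w - of_real b :: complex) = - 1 * of_real (b - w)" by simp
    then have "(of_real w - of_real b :: complex) ^ k = (- 1) ^ k * of_real ((b - w) ^ k)"
      by (simp only: power_mult_distrib of_real_power)
    then have "(deriv ^^ k) K (of_real b) / fact k * (of_real w - of_real b) ^ k
        = ((- 1) ^ k * (- 1) ^ k) * (of_real S * of_real ((b - w) ^ k) / fact k)"
      unfolding higher_deriv[OF bU] S(2) by simp
    also have "\<dots> = of_real (S * ((b - w) ^ k / fact k))"
      by (simp flip: power_add)
    finally have "(deriv ^^ k) K (of_real b) / fact k * (of_real w - of_real b) ^ k = of_real (S * ((b - w) ^ k / fact k))" .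
    moreover have "f k sums (S * ((b - w) ^ k / fact k))"
      using sums_mult2[OF S(1), of "(b - w) ^ k / fact k"]
      by (simp add: f_def[abs_def] power_mult_distrib mult_ac)
    ultimately show ?thesis by blast
  qed
  then obtain t where t: "\<And>k. f k sums t k"
      "\<And>k. (deriv ^^ k) K (of_real b) / fact k * (of_real w - of_real b) ^ k = of_real (t k)" by metis
  have "summable t"
    using taylor unfolding t(2) by (metis sums_summable summable_complex_of_real)
  \<comment> \<open>Only finite sums over \<open>n\<close> are exchanged with the series over
    \<open>k\<close>; nonnegativity bounds all of them by the Taylor sum.\<close>
  have "summable (\<lambda>n. c n * real n powr (- w))"
  proof (rule summableI_nonneg_bounded)
    show "0 \<le> c n * real n powr - w" for n using c by simp
    fix M
    have "(\<lambda>k. \<Sum>n<M. f k n) sums (\<Sum>n<M. c n * real n powr (- w))"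
    proof (rule sums_sum)
      fix n
      have "(\<lambda>k. ((b - w) * ln (real n)) ^ k / fact k) sums exp ((b - w) * ln (real n))"
        using exp_converges[of "(b - w) * ln (real n)"] by (simp add: divide_inverse mult_ac)
      then have "(\<lambda>k. f k n) sums (c n * real n powr (- b) * exp ((b - w) * ln (real n)))"
        unfolding f_def by (rule sums_mult)
      also have "c n * real n powr (- b) * exp ((b - w) * ln (real n)) = c n * real n powr (- w)"
        by (cases "n = 0") (auto simp: powr_def algebra_simps simp flip: exp_add)
      finally show "(\<lambda>k. f k n) sums (c n * real n powr (- w))" .
    qed
    note swapped = this
    have "(\<Sum>n<M. f k n) \<le> t k" for k
      using sum_le_suminf[of "f k" "{..<M}"] t(1)[of k] f0 by (simp add: sums_iff)
    then show "(\<Sum>n<M. c n * real n powr - w) \<le> suminf t"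
      by (rule sums_le[OF _ swapped summable_sums[OF \<open>summable t\<close>]])
  qed
  then show ?thesis
    using r c by (intro exI[of _ w]) (simp add: abs_conv_at_def w_def)
qed

lemma mangoldt_square: "mangoldt (n ^ 2) = (mangoldt n :: real)"
proof (cases "n = 0")
  case False
  then show ?thesis
    by (auto simp: mangoldt_def primepow_power_iff_nat aprimedivisor_primepow_power)
qed simp

text \<open>With \<open>x = Re z\<close> the right side is
  \<open>(2 * x + 1 / 2) ^ 2 + 7 / 4\<close>. The weight at \<open>z\<close> alone vanishes at -1,
  but the weight at the square is then 4.\<close>

lemma Re_double_angle_bound:
  assumes "norm (z :: complex) = 1"
  shows "7 / 4 \<le> (2 + 2 * Re z) + (2 + 2 * Re (z ^ 2))"
proof -
  have "Re (z ^ 2) = 2 * Re z ^ 2 - 1"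
    using assms by (simp add: cmod_def power2_eq_square)
  moreover have "0 \<le> (2 * Re z + 1 / 2) ^ 2" by simp
  ultimately show ?thesis by (simp add: power2_eq_square algebra_simps)
qed

lemma dser_add:
  assumes "abs_conv_at a \<sigma>" "abs_conv_at b \<sigma>" "\<sigma> \<le> Re s"
  shows "dser (\<lambda>n. a n + b n) s = dser a s + dser b s"
  using sums_add[OF dser_sums[OF assms(1,3)] dser_sums[OF assms(2,3)]]
  by (simp add: dser_def sums_iff distrib_right)

lemma dser_cnj:
  assumes "abs_conv_at a \<sigma>" "\<sigma> \<le> Re s"
  shows "dser (\<lambda>n. cnj (a n)) s = cnj (dser a (cnj s))"
proof -
  have "(\<lambda>n. cnj (a n * of_nat n powr (- cnj s))) sums cnj (dser a (cnj s))"
    using assms by (subst sums_cnj) (auto intro: dser_sums)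
  moreover have "cnj (of_nat n powr (- cnj s)) = (of_nat n powr (- s) :: complex)" for n
    by (subst cnj_powr) auto
  ultimately show ?thesis by (simp add: dser_def sums_iff)
qed

text \<open>Otherwise the logarithmic derivative would be bounded on \<open>Re s > 1\<close>,
  whereas the pole makes it grow like \<open>1 / (s - 1)\<close>.\<close>

lemma mangoldt_principal_not_summable:
  assumes g: "bdd_compl_mult g" and A: "A \<noteq> 0"
    and E: "E holomorphic_on {s. Re s > 0}" "\<And>s. Re s > 1 \<Longrightarrow> dser g s = A / (s - 1) + E s"
  shows "\<not> abs_conv_at (\<lambda>n. mangoldt n * g n) 1"
proof
  let ?k = "dser (\<lambda>n. mangoldt n * g n)"
  assume conv: "abs_conv_at (\<lambda>n. mangoldt n * g n) 1"
  define M where "M = (\<Sum>n. norm (mangoldt n * g n) * real n powr - 1)"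
  have bound: "norm (?k s) \<le> M" if "Re s \<ge> 1" for s
  proof -
    have "norm (?k s) \<le> (\<Sum>n. norm (mangoldt n * g n) * real n powr - 1)"
      unfolding dser_def
    proof (rule norm_suminf_le)
      fix n :: nat
      show "norm (mangoldt n * g n * of_nat n powr - s) \<le> norm (mangoldt n * g n) * real n powr - 1"
        using that unfolding norm_mult[of _ "of_nat n powr - s"] norm_nat_powr
        by (cases "n = 0") (simp, intro mult_left_mono powr_mono, auto)
    qed (use conv in \<open>simp add: abs_conv_at_def\<close>)
    then show ?thesis by (simp add: M_def)
  qed
  have S: "open {s. Re s > 0}" "open {s. Re s > 1}" by (rule open_halfspace_Re_gt)+
  \<comment> \<open>The logarithmic derivative relation multiplied by \<open>(s - 1) ^ 2\<close>: as
    \<open>s\<close> tends to 1, the left side tends to 0 because \<open>?k\<close> is bounded, the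
    right side to \<open>A\<close>.\<close>
  have key: "?k s * ((s - 1) * (A + (s - 1) * E s)) = A - (s - 1) ^ 2 * deriv E s" if s: "Re s > 1" for s
  proof -
    have ne: "s \<noteq> 1" using s by auto
    have "(E has_field_derivative deriv E s) (at s)"
      using E(1) S(1) s by (intro holomorphic_derivI) auto
    then have "((\<lambda>s. A / (s - 1) + E s) has_field_derivative - A / (s - 1) ^ 2 + deriv E s) (at s)"
      using ne by (auto intro!: derivative_eq_intros simp: power2_eq_square)
    then have "(dser g has_field_derivative - A / (s - 1) ^ 2 + deriv E s) (at s)"
      by (rule has_field_derivative_transform_within_open[OF _ S(2)]) (use s E(2) in auto)
    then have "?k s * (A / (s - 1) + E s) = A / (s - 1) ^ 2 - deriv E s"
      using dser_mangoldt_mult[OF g s] E(2)[OF s] by (simp add: DERIV_imp_deriv)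
    moreover have "u * (A + u * x) = (A / u + x) * u ^ 2" "A - u ^ 2 * y = (A / u ^ 2 - y) * u ^ 2"
      if "u \<noteq> 0" for u x y :: complex
      using that by (auto simp: field_simps power2_eq_square)
    ultimately show ?thesis
      using ne by (simp only: right_minus_eq mult.assoc[symmetric] not_False_eq_True)
  qed
  define s where "s n = (1 + of_real (inverse (real (Suc n))) :: complex)" for n
  have s1: "Re (s n) > 1" for n by (simp add: s_def)
  have lim: "s \<longlonglongrightarrow> 1"
    using tendsto_add[OF tendsto_const[of "1::complex"] tendsto_of_real[OF LIMSEQ_inverse_real_of_nat]]
    by (simp add: s_def[abs_def])
  have "isCont h 1" if "h holomorphic_on {s. Re s > 0}" for h
    using holomorphic_on_imp_continuous_on[OF that] S(1) by (simp add: continuous_on_eq_continuous_at)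
  then have "isCont E 1" "isCont (deriv E) 1"
    using E(1) holomorphic_deriv[OF E(1) S(1)] by blast+
  then have E_lim: "(\<lambda>n. E (s n)) \<longlonglongrightarrow> E 1" "(\<lambda>n. deriv E (s n)) \<longlonglongrightarrow> deriv E 1"
    using lim by (auto intro: isCont_tendsto_compose)
  have r: "(\<lambda>n. A - (s n - 1) ^ 2 * deriv E (s n)) \<longlonglongrightarrow> A - (1 - 1) ^ 2 * deriv E 1"
    by (intro tendsto_intros lim E_lim)
  have "(\<lambda>n. (s n - 1) * (A + (s n - 1) * E (s n))) \<longlonglongrightarrow> (1 - 1) * (A + (1 - 1) * E 1)"
    by (intro tendsto_intros lim E_lim)
  then have "(\<lambda>n. M * norm ((s n - 1) * (A + (s n - 1) * E (s n)))) \<longlonglongrightarrow> M * 0"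
    by (intro tendsto_mult tendsto_const tendsto_norm_zero) simp
  then have "(\<lambda>n. M * norm ((s n - 1) * (A + (s n - 1) * E (s n)))) \<longlonglongrightarrow> 0"
    by (simp only: mult_zero_right)
  note M_lim = this
  have "norm (?k (s n) * ((s n - 1) * (A + (s n - 1) * E (s n))))
      \<le> M * norm ((s n - 1) * (A + (s n - 1) * E (s n)))" for n
    unfolding norm_mult[of "?k (s n)"] by (rule mult_right_mono[OF bound[OF less_imp_le[OF s1]] norm_ge_zero])
  then have "\<forall>\<^sub>F n in sequentially. norm (?k (s n) * ((s n - 1) * (A + (s n - 1) * E (s n))))
      \<le> M * norm ((s n - 1) * (A + (s n - 1) * E (s n)))"
    by (intro always_eventually allI)
  from Lim_null_comparison[OF this M_lim]
  have "(\<lambda>n. ?k (s n) * ((s n - 1) * (A + (s n - 1) * E (s n)))) \<longlonglongrightarrow> 0" .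
  then have "(\<lambda>n. A - (s n - 1) ^ 2 * deriv E (s n)) \<longlonglongrightarrow> 0" by (simp only: key[OF s1])
  then show False using LIMSEQ_unique[OF r] A by simp
qed

text \<open>The exponent 1/2 serves twice: at \<open>n\<close> it is weaker than the exponent 1, and
  at \<open>n ^ 2\<close> it equals the exponent 1 in \<open>n\<close>. As \<open>mangoldt\<close>
  agrees on \<open>n\<close> and \<open>n ^ 2\<close>, the two weights add up to at least
  \<open>7 / 4\<close> by \<open>Re_double_angle_bound\<close>.\<close>

lemma mangoldt_conv_imp_principal_conv:
  fixes g :: "nat \<Rightarrow> complex"
  assumes g: "bdd_compl_mult g" "\<And>n. norm (g n) \<in> {0, 1}"
    and conv: "abs_conv_at (\<lambda>n. of_real (mangoldt n * (2 * norm (g n) + 2 * Re (g n)))) (1 / 2)"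
  shows "abs_conv_at (\<lambda>n. mangoldt n * of_real (norm (g n))) 1"
proof -
  define c where "c n = mangoldt n * (2 * norm (g n) + 2 * Re (g n))" for n
  have c0: "c n \<ge> 0" for n
    using abs_Re_le_cmod[of "g n"] by (auto simp: c_def mangoldt_nonneg)
  define f where "f n = c n * real n powr (- 1 / 2)" for n
  have f: "summable f"
    using conv c0 by (simp add: abs_conv_at_def f_def[abs_def] abs_of_nonneg flip: c_def of_real_mult)
  moreover have "inj (\<lambda>n::nat. n ^ 2)" by (auto intro!: injI)
  ultimately have "summable (f \<circ> (\<lambda>n. n ^ 2))" using c0 by (intro summable_reindex) (auto simp: f_def)
  then have "summable (\<lambda>n. 4 / 7 * (f n + f (n ^ 2)))"
    using f by (intro summable_mult summable_add) (auto simp: o_def)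
  then show ?thesis
    unfolding abs_conv_at_def
  proof (rule summable_comparison_test'[where N = 1])
    fix n :: nat assume n: "n \<ge> 1"
    have f1: "c n * real n powr - 1 \<le> f n"
      unfolding f_def using c0 n by (intro mult_left_mono powr_mono) auto
    have f2: "f (n ^ 2) = c (n ^ 2) * real n powr - 1"
    proof -
      have "real (n ^ 2) powr (- 1 / 2) = (real n powr 2) powr (- 1 / 2)"
        using n by simp
      also have "\<dots> = real n powr - 1" by (subst powr_powr) simp
      finally show ?thesis by (simp only: f_def)
    qed
    have "mangoldt n * norm (g n) * (7 / 4) \<le> c n + c (n ^ 2)"
    proof -
      have sq: "g (n ^ 2) = g n ^ 2" using g(1) by (simp add: bdd_compl_mult_def power2_eq_square)
      consider "norm (g n) = 0" | "norm (g n) = 1" using g(2)[of n] by auto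
      then show ?thesis
      proof cases
        case 2
        have "mangoldt n * (7 / 4) \<le> mangoldt n * ((2 + 2 * Re (g n)) + (2 + 2 * Re (g n ^ 2)))"
          using Re_double_angle_bound[OF 2] mangoldt_nonneg by (rule mult_left_mono)
        then show ?thesis using 2 by (simp add: c_def mangoldt_square sq norm_power algebra_simps)
      qed (simp add: c_def sq)
    qed
    then have "mangoldt n * norm (g n) * real n powr - 1 \<le> 4 / 7 * (c n + c (n ^ 2)) * real n powr - 1"
      by (intro mult_right_mono) auto
    also have "\<dots> = 4 / 7 * (c n * real n powr - 1 + c (n ^ 2) * real n powr - 1)"
      by (simp only: distrib_right mult.assoc)
    also have "\<dots> \<le> 4 / 7 * (f n + f (n ^ 2))"
      by (intro mult_left_mono add_mono f1 eq_refl[OF f2[symmetric]]) simp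
    finally have "mangoldt n * norm (g n) * real n powr - 1 \<le> 4 / 7 * (f n + f (n ^ 2))" .
    moreover have "norm (norm (mangoldt n * of_real (norm (g n)) :: complex) * real n powr - 1)
        = mangoldt n * norm (g n) * real n powr - 1"
      by (simp add: norm_mult abs_mult)
    ultimately show "norm (norm (mangoldt n * of_real (norm (g n)) :: complex) * real n powr - 1) \<le> 4 / 7 * (f n + f (n ^ 2))"
      by (simp only:)
  qed
qed

text \<open>If \<open>L(1 + it) = 0\<close>, this zero cancels the pole of \<open>L\<^sub>0\<close> in \<open>P(s) = L\<^sub>0(s) L(s + it)\<close>, so
  \<open>G(s) = P(s) P(s\<^sup>*)\<^sup>*\<close> is holomorphic near the positive real axis and \<open>- G'/G\<close> is a Dirichlet series with
  nonnegative coefficients. Hence \<open>G\<close> decreases along the real axis, cannot vanish at the abscissa of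
  convergence of that series, and Landau's argument pushes the abscissa below 1/2, where the series diverges.\<close>

lemma abscissa_descent:
  fixes c :: "nat \<Rightarrow> real"
  assumes c: "\<And>n. c n \<ge> 0" and conv: "\<And>\<sigma>. \<sigma> > 1 \<Longrightarrow> abs_conv_at (\<lambda>n. of_real (c n)) \<sigma>"
    and U: "open U" "convex U" "\<And>\<sigma>. \<sigma> > 0 \<Longrightarrow> of_real \<sigma> \<in> U" and G: "G holomorphic_on U"
    and G_deriv: "\<And>s. s \<in> U \<Longrightarrow> Re s > 1 \<Longrightarrow> deriv G s = - dser (\<lambda>n. of_real (c n)) s * G s"
    and G_real: "\<And>\<sigma>. \<sigma> > 0 \<Longrightarrow> Im (G (of_real \<sigma>)) = 0" "\<And>\<sigma>. \<sigma> > 0 \<Longrightarrow> Re (G (of_real \<sigma>)) \<ge> 0"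
    and G2: "G 2 \<noteq> 0" and \<sigma>1: "\<sigma>1 > 0"
  shows "abs_conv_at (\<lambda>n. of_real (c n)) \<sigma>1"
proof (rule ccontr)
  let ?K = "dser (\<lambda>n. of_real (c n))"
  assume not_conv: "\<not> abs_conv_at (\<lambda>n. of_real (c n)) \<sigma>1"
  define X where "X = {\<sigma>. abs_conv_at (\<lambda>n. of_real (c n)) \<sigma>}"
  have X_gt: "\<sigma> > \<sigma>1" if "\<sigma> \<in> X" for \<sigma>
    using that not_conv abs_conv_at_mono[of _ \<sigma> \<sigma>1] by (force simp: X_def)
  then have bdd: "bdd_below X" by (intro bdd_belowI[of _ \<sigma>1]) (auto intro: less_imp_le)
  have X1: "\<sigma> \<in> X" if "\<sigma> > 1" for \<sigma> using that conv by (simp add: X_def)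
  then have "X \<noteq> {}" using gt_ex by blast
  define \<sigma>0 where "\<sigma>0 = Inf X"
  have "\<sigma>0 \<ge> \<sigma>1" unfolding \<sigma>0_def using \<open>X \<noteq> {}\<close> X_gt by (intro cInf_greatest) (auto intro: less_imp_le)
  then have pos: "\<sigma>0 > 0" using \<sigma>1 by linarith
  have le1: "\<sigma>0 \<le> 1"
  proof (rule field_le_epsilon)
    show "\<sigma>0 \<le> 1 + e" if "e > 0" for e
      unfolding \<sigma>0_def using that by (intro cInf_lower X1 bdd) auto
  qed
  have conv0: "abs_conv_at (\<lambda>n. of_real (c n)) \<sigma>" if gt: "\<sigma> > \<sigma>0" for \<sigma>
  proof -
    obtain x where "x \<in> X" "x < \<sigma>" using gt cInf_lessD[OF \<open>X \<noteq> {}\<close>, of \<sigma>] unfolding \<sigma>0_def by blast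
    then show ?thesis using abs_conv_at_mono[of _ x \<sigma>] by (simp add: X_def)
  qed
  define W where "W = U \<inter> {s. \<sigma>0 < Re s}"
  have W: "open W" "connected W"
    unfolding W_def using U
    by (auto intro!: open_Int open_halfspace_Re_gt convex_connected convex_Int convex_halfspace_Re_gt)
  have K: "?K holomorphic_on W"
    unfolding holomorphic_on_def
  proof
    fix s assume "s \<in> W"
    then obtain \<sigma> where "\<sigma>0 < \<sigma>" "\<sigma> < Re s" using dense[of \<sigma>0 "Re s"] by (auto simp: W_def)
    then show "?K field_differentiable (at s within W)"
      using dser_has_field_derivative[OF conv0] field_differentiable_def field_differentiable_at_within by blast
  qed
  \<comment> \<open>Known for \<open>Re s > 1\<close>; both sides are holomorphic on the connected
    set \<open>W\<close>, so the identity theorem extends it up to \<open>\<sigma>0\<close>.\<close>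
  have log_deriv: "deriv G s = - ?K s * G s" if "s \<in> W" for s
  proof (rule analytic_continuation_open[where s = "U \<inter> {s. 1 < Re s}" and s' = W and f = "deriv G" and z = s])
    show "open (U \<inter> {s. 1 < Re s})" using U(1) by (intro open_Int open_halfspace_Re_gt)
    have "of_real 2 \<in> U" by (rule U(3)) simp
    then show "U \<inter> {s. 1 < Re s} \<noteq> {}" by (auto intro!: exI[of _ 2])
    show "deriv G holomorphic_on W"
      using holomorphic_deriv[OF G U(1)] by (rule holomorphic_on_subset) (auto simp: W_def)
    show "(\<lambda>s. - ?K s * G s) holomorphic_on W"
      using G by (intro holomorphic_intros K) (auto simp: W_def intro: holomorphic_on_subset)
  qed (use W le1 that G_deriv in \<open>auto simp: W_def\<close>)
  define \<phi> where "\<phi> \<sigma> = Re (G (of_real \<sigma>))" for \<sigma>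
  have antimono: "\<phi> \<sigma> \<ge> \<phi> 2" if \<sigma>: "\<sigma>0 < \<sigma>" "\<sigma> \<le> 2" for \<sigma>
  proof (rule DERIV_nonpos_imp_nonincreasing[OF \<sigma>(2)])
    fix x assume x: "\<sigma> \<le> x" "x \<le> 2"
    then have "x > 0" "x > \<sigma>0" using \<sigma> pos by auto
    then have xW: "of_real x \<in> W" using U(3) by (simp add: W_def)
    then have "(G has_field_derivative deriv G (of_real x)) (at (of_real x))"
      using G U(1) by (intro holomorphic_derivI) (auto simp: W_def)
    then have "((\<lambda>x. G (of_real x)) has_vector_derivative deriv G (of_real x)) (at x)"
      by (rule has_vector_derivative_real_field)
    from bounded_linear.has_vector_derivative[OF bounded_linear_Re this]
    have "(\<phi> has_real_derivative Re (deriv G (of_real x))) (at x)"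
      by (simp add: \<phi>_def[abs_def] has_real_derivative_iff_has_vector_derivative)
    moreover have "Re (deriv G (of_real x)) \<le> 0"
    proof -
      obtain S where S: "(\<lambda>n. c n * real n powr (- x)) sums S" "?K (of_real x) = of_real S"
        using dser_of_real_sums[OF conv0[OF \<open>x > \<sigma>0\<close>]] by blast
      have "S \<ge> 0" using S(1) c by (intro sums_le[OF _ sums_zero S(1)]) auto
      then show ?thesis
        using log_deriv[OF xW] S(2) G_real[OF \<open>x > 0\<close>] by simp
    qed
    ultimately show "\<exists>y. (\<phi> has_real_derivative y) (at x) \<and> y \<le> 0" by blast
  qed
  have "\<phi> 2 > 0"
    using G_real[of 2] G2 by (auto simp: \<phi>_def complex_eq_iff order_less_le)
  have contG: "continuous_on U G" by (rule holomorphic_on_imp_continuous_on[OF G])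
  have "G (of_real \<sigma>0) \<noteq> 0"
  proof
    assume 0: "G (of_real \<sigma>0) = 0"
    have "isCont G (of_real \<sigma>0)"
      using contG U(1) U(3)[OF pos] by (simp add: continuous_on_eq_continuous_at)
    from isCont_Re[OF isCont_o2[OF isCont_of_real[OF continuous_ident] this]]
    have "isCont \<phi> \<sigma>0" by (simp add: \<phi>_def[abs_def])
    from isContD[OF this] have "(\<phi> \<longlongrightarrow> \<phi> \<sigma>0) (at_right \<sigma>0)"
      by (simp only: filterlim_at_split)
    moreover have "\<forall>\<^sub>F \<sigma> in at_right \<sigma>0. \<phi> \<sigma> \<ge> \<phi> 2"
    proof (rule eventually_mono[OF eventually_at_right_real[of \<sigma>0 2]])
      show "\<sigma>0 < 2" using le1 by simp
      show "\<phi> 2 \<le> \<phi> \<sigma>" if "\<sigma> \<in> {\<sigma>0<..<2}" for \<sigma>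
        using that by (intro antimono) auto
    qed
    ultimately have "\<phi> 2 \<le> \<phi> \<sigma>0"
      by (intro tendsto_lowerbound[of \<phi> _ "at_right \<sigma>0"]) auto
    then show False using \<open>\<phi> 2 > 0\<close> 0 by (simp add: \<phi>_def)
  qed
  then obtain e where e: "e > 0" "\<And>s. s \<in> ball (of_real \<sigma>0) e \<Longrightarrow> s \<in> U \<Longrightarrow> G s \<noteq> 0"
    using continuous_on_avoid[OF contG U(3)[OF pos], of 0] by (auto simp: dist_commute)
  obtain r' where r': "r' > 0" "ball (of_real \<sigma>0) r' \<subseteq> U"
    using U(1) U(3)[OF pos] openE by blast
  define r where "r = min e r'"
  have r: "r > 0" "ball (of_real \<sigma>0) r \<subseteq> U" "\<And>s. s \<in> ball (of_real \<sigma>0) r \<Longrightarrow> G s \<noteq> 0"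
    using e r' by (auto simp: r_def)
  have "\<exists>\<sigma><\<sigma>0. abs_conv_at (\<lambda>n. of_real (c n)) \<sigma>"
  proof (rule landau_singularity[OF c conv0 _ r(1)])
    show "(\<lambda>s. - deriv G s / G s) holomorphic_on ball (of_real \<sigma>0) r"
      using holomorphic_on_subset[OF G r(2)] holomorphic_on_subset[OF holomorphic_deriv[OF G U(1)] r(2)] r(3)
      by (intro holomorphic_intros) auto
    show "- deriv G s / G s = ?K s" if "s \<in> ball (of_real \<sigma>0) r" "Re s > \<sigma>0" for s
      using log_deriv[of s] r(2) r(3)[OF that(1)] that by (auto simp: W_def)
  qed
  then obtain \<sigma> where "\<sigma> < \<sigma>0" "\<sigma> \<in> X" by (auto simp: X_def)
  then show False using cInf_lower[OF _ bdd, of \<sigma>] by (simp add: \<sigma>0_def)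
qed

theorem dser_nonvanishing:
  assumes \<psi>: "bdd_compl_mult \<psi>" "\<And>n. norm (\<psi> n) \<in> {0, 1}"
    and E0: "E0 holomorphic_on {s. Re s > 0}"
      "\<And>s. Re s > 1 \<Longrightarrow> dser (\<lambda>n. of_real (norm (\<psi> n))) s = A0 / (s - 1) + E0 s" "A0 \<noteq> 0"
    and E: "E holomorphic_on {s. Re s > 0}" "\<And>s. Re s > 1 \<Longrightarrow> dser \<psi> s = A / (s - 1) + E s"
    and t: "A = 0 \<or> t \<noteq> 0"
  shows "A / (\<i> * of_real t) + E (1 + \<i> * of_real t) \<noteq> 0"
proof
  assume zero: "A / (\<i> * of_real t) + E (1 + \<i> * of_real t) = 0"
  define g where "g n = \<psi> n * of_nat n powr (- (\<i> * of_real t))" for n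
  define h where "h n = (of_real (norm (g n)) :: complex)" for n
  \<comment> \<open>The factor \<open>0 powr\<close> makes \<open>g 0 = 0\<close> even if
    \<open>\<psi> 0 = 1\<close>, as happens for modulus 1; \<open>dser\<close> ignores this
    index.\<close>
  have norm_g: "norm (g n) = (if n = 0 then 0 else norm (\<psi> n))" for n
    by (simp add: g_def norm_mult norm_nat_powr)
  have g: "bdd_compl_mult g"
    using \<psi>(1) unfolding bdd_compl_mult_def
    by (auto simp: norm_g) (auto simp: g_def nat_powr_mult simp del: of_nat_mult)
  have h: "bdd_compl_mult h"
    using g by (auto simp: bdd_compl_mult_def h_def norm_mult)
  have dser_h: "dser h s = A0 / (s - 1) + E0 s" if "Re s > 1" for s
    using E0(2)[OF that] dser_cong[of h "\<lambda>n. of_real (norm (\<psi> n))" s] by (simp add: h_def norm_g)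
  have dser_g: "dser g s = A / (s - 1 + \<i> * of_real t) + E (s + \<i> * of_real t)" if "Re s > 1" for s
  proof -
    have "dser g s = dser \<psi> (s + \<i> * of_real t)"
    proof -
      have "g n * of_nat n powr (- s) = \<psi> n * of_nat n powr (- (s + \<i> * of_real t))" for n
        unfolding g_def mult.assoc powr_add[symmetric] by (simp add: add.commute)
      then show ?thesis by (simp only: dser_def)
    qed
    then show ?thesis using E(2)[of "s + \<i> * of_real t"] that by (simp add: algebra_simps)
  qed
  \<comment> \<open>The shifted series has its pole at \<open>1 - i t\<close>, outside the strip of
    half-width \<open>\<bar>t\<bar>\<close>. For \<open>t = 0\<close> the assumption gives
    \<open>A = 0\<close>, there is no pole, and any width will do.\<close>
  define \<tau> where "\<tau> = (if t = 0 then 1 else \<bar>t\<bar>)"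
  define U where "U = {s. Re s > 0} \<inter> {s. Im s > - \<tau>} \<inter> {s. Im s < \<tau>}"
  have \<tau>: "\<tau> > 0" by (simp add: \<tau>_def)
  have U: "open U" "convex U" unfolding U_def
    by (auto intro!: open_Int open_halfspace_Re_gt open_halfspace_Im_gt open_halfspace_Im_lt
          convex_Int convex_halfspace_Re_gt convex_halfspace_Im_gt convex_halfspace_Im_lt)
  have U_real: "of_real \<sigma> \<in> U" if "\<sigma> > 0" for \<sigma>
    using that \<tau> by (simp add: U_def)
  have cnj_U: "cnj s \<in> U \<longleftrightarrow> s \<in> U" for s by (auto simp: U_def)
  have S1: "open (U \<inter> {s. Re s > 1})" using U(1) by (intro open_Int open_halfspace_Re_gt)

  define Lt where "Lt s = A / (s - 1 + \<i> * of_real t) + E (s + \<i> * of_real t)" for s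
  have "(\<lambda>s. A / (s - 1 + \<i> * of_real t)) holomorphic_on U"
  proof (cases "A = 0")
    case False
    then have "s - 1 + \<i> * of_real t \<noteq> 0" if "s \<in> U" for s
      using t that by (auto simp: U_def \<tau>_def complex_eq_iff)
    then show ?thesis by (intro holomorphic_intros) auto
  qed simp
  moreover have "(\<lambda>s. E (s + \<i> * of_real t)) holomorphic_on U"
    by (intro holomorphic_on_compose_gen[of "\<lambda>s. s + \<i> * of_real t" U E "{s. Re s > 0}", unfolded o_def])
       (auto intro!: holomorphic_intros E(1) simp: U_def)
  ultimately have Lt: "Lt holomorphic_on U" unfolding Lt_def by (rule holomorphic_on_add)
  have "Lt 1 = 0" using zero by (simp add: Lt_def)
  \<comment> \<open>The assumed zero makes \<open>Lt s / (s - 1)\<close> holomorphic at 1; the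
    factor \<open>s - 1\<close> taken out here clears the pole of \<open>dser h\<close> in
    \<open>P\<close>.\<close>
  define Q where "Q s = (if s = 1 then deriv Lt 1 else (Lt s - Lt 1) / (s - 1))" for s
  have Q: "Q holomorphic_on U" unfolding Q_def by (rule pole_lemma_open[OF Lt U(1)])
  define P where "P s = (A0 + (s - 1) * E0 s) * Q s" for s
  have P: "P holomorphic_on U"
    unfolding P_def using E0(1)
    by (intro holomorphic_intros Q) (auto simp: U_def intro: holomorphic_on_subset)
  have P_eq: "P s = dser h s * dser g s" if "Re s > 1" for s
  proof -
    have "s \<noteq> 1" using that by auto
    then have "P s = (A0 + (s - 1) * E0 s) * (Lt s / (s - 1))" using \<open>Lt 1 = 0\<close> by (simp add: P_def Q_def)
    moreover have "dser h s = (A0 + (s - 1) * E0 s) / (s - 1)"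
      using dser_h[OF that] \<open>s \<noteq> 1\<close> by (simp add: add_divide_distrib)
    moreover have "dser g s = Lt s" using dser_g[OF that] by (simp only: Lt_def)
    ultimately show ?thesis by simp
  qed
  define u where "u n = mangoldt n * (h n + g n)" for n
  have P_deriv: "deriv P s = - dser u s * P s" if s: "s \<in> U" "Re s > 1" for s
  proof -
    obtain \<sigma> where \<sigma>: "1 < \<sigma>" "\<sigma> < Re s" using dense[OF s(2)] by blast
    have "dser u s = dser (\<lambda>n. mangoldt n * h n) s + dser (\<lambda>n. mangoldt n * g n) s"
      unfolding u_def distrib_left using g h \<sigma>
      by (intro dser_add[of _ \<sigma>] mangoldt_abs_conv[of _ 1]) (auto simp: bdd_compl_mult_def)
    moreover have "deriv (dser h) s = - (dser (\<lambda>n. mangoldt n * h n) s * dser h s)"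
        "deriv (dser g) s = - (dser (\<lambda>n. mangoldt n * g n) s * dser g s)"
      by (simp_all only: dser_mangoldt_mult[OF h s(2)] dser_mangoldt_mult[OF g s(2)] minus_minus)
    ultimately have eq: "- dser u s * P s = deriv (dser h) s * dser g s + deriv (dser g) s * dser h s"
      unfolding P_eq[OF s(2)] by (simp add: algebra_simps)
    have "(dser h has_field_derivative deriv (dser h) s) (at s)"
        "(dser g has_field_derivative deriv (dser g) s) (at s)"
      using dser_has_field_derivative[OF bdd_compl_mult_abs_conv[OF g \<sigma>(1)] \<sigma>(2)]
        dser_has_field_derivative[OF bdd_compl_mult_abs_conv[OF h \<sigma>(1)] \<sigma>(2)]
      by (metis DERIV_imp_deriv)+
    then have "((\<lambda>s. dser h s * dser g s) has_field_derivative
        deriv (dser h) s * dser g s + deriv (dser g) s * dser h s) (at s)"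
      by (rule DERIV_mult)
    then have "(P has_field_derivative deriv (dser h) s * dser g s + deriv (dser g) s * dser h s) (at s)"
      by (rule has_field_derivative_transform_within_open[OF _ S1]) (use s P_eq in auto)
    then show ?thesis unfolding eq by (rule DERIV_imp_deriv)
  qed
  define G where "G s = P s * cnj (P (cnj s))" for s
  have cnj_image: "cnj ` U = U" using cnj_U by (auto simp: image_iff intro!: bexI[of _ "cnj _"])
  have "(cnj \<circ> P \<circ> cnj) holomorphic_on U"
    using P U(1) by (intro holomorphic_on_compose_cnj_cnj) (simp_all add: cnj_image)
  then have G: "G holomorphic_on U"
    unfolding G_def using P by (intro holomorphic_intros) (simp_all add: o_def)
  \<comment> \<open>Conjugate symmetrisation replaces \<open>u n\<close> by twice its real part; the
    coefficients become real and, by \<open>Re (g n) >= - norm (g n)\<close>, nonnegative.\<close>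
  define c where "c n = mangoldt n * (2 * norm (g n) + 2 * Re (g n))" for n
  have c_eq: "of_real (c n) = u n + cnj (u n)" for n
    by (simp add: c_def u_def h_def complex_eq_iff)
  have u_conv: "abs_conv_at u \<sigma>" if "\<sigma> > 1" for \<sigma>
    unfolding u_def
  proof (rule mangoldt_abs_conv[OF _ that])
    show "norm (h n + g n) \<le> 2" for n
      using g h norm_triangle_ineq[of "h n" "g n"] by (simp add: bdd_compl_mult_def) (smt (verit))
  qed
  then have cnj_u_conv: "abs_conv_at (\<lambda>n. cnj (u n)) \<sigma>" if "\<sigma> > 1" for \<sigma>
    using that by (simp add: abs_conv_at_def)
  have dser_c: "dser (\<lambda>n. of_real (c n)) s = dser u s + cnj (dser u (cnj s))" if "Re s > 1" for s
  proof -
    obtain \<sigma> where \<sigma>: "1 < \<sigma>" "\<sigma> < Re s" using dense[OF \<open>Re s > 1\<close>] by blast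
    show ?thesis
      unfolding c_eq using dser_add[OF u_conv[OF \<sigma>(1)] cnj_u_conv[OF \<sigma>(1)], of s]
        dser_cnj[OF u_conv[OF \<sigma>(1)], of s] \<sigma> by simp
  qed
  have "abs_conv_at (\<lambda>n. of_real (c n)) (1 / 2)"
  proof (rule abscissa_descent[OF _ _ U U_real G])
    show "c n \<ge> 0" for n
      using abs_Re_le_cmod[of "g n"] by (auto simp: c_def mangoldt_nonneg)
    show "abs_conv_at (\<lambda>n. of_real (c n)) \<sigma>" if "\<sigma> > 1" for \<sigma>
    proof -
      have "abs_conv_at (\<lambda>n. mangoldt n * of_real (2 * norm (g n) + 2 * Re (g n))) \<sigma>"
      proof (rule mangoldt_abs_conv[OF _ that])
        fix n
        have "norm (g n) \<le> 1" using g by (simp add: bdd_compl_mult_def)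
        then show "norm (of_real (2 * norm (g n) + 2 * Re (g n)) :: complex) \<le> 4"
          using abs_Re_le_cmod[of "g n"] unfolding norm_of_real by linarith
      qed
      then show ?thesis by (simp add: c_def)
    qed
    show "deriv G s = - dser (\<lambda>n. of_real (c n)) s * G s" if s: "s \<in> U" "Re s > 1" for s
    proof -
      have dP: "(P has_field_derivative deriv P s) (at s)" if "s \<in> U" for s
        using P U(1) that by (rule holomorphic_derivI)
      have "cnj s \<in> U" using s cnj_U by simp
      have "((\<lambda>s. cnj (P (cnj s))) has_field_derivative cnj (deriv P (cnj s))) (at s)"
        using has_field_derivative_cnj_cnj[OF dP[OF \<open>cnj s \<in> U\<close>]] by (simp add: o_def)
      from DERIV_mult[OF dP[OF s(1)] this]
      have "deriv G s = deriv P s * cnj (P (cnj s)) + cnj (deriv P (cnj s)) * P s"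
        unfolding G_def by (rule DERIV_imp_deriv)
      also have "\<dots> = - dser (\<lambda>n. of_real (c n)) s * G s"
        using s \<open>cnj s \<in> U\<close> by (simp add: P_deriv dser_c G_def algebra_simps)
      finally show ?thesis .
    qed
    show "Im (G (of_real \<sigma>)) = 0" "Re (G (of_real \<sigma>)) \<ge> 0" for \<sigma>
      by (simp_all add: G_def complex_mult_cnj)
    \<comment> \<open>At 2 each factor is inverted by its Moebius series, which excludes a
      zero.\<close>
    have "dser h 2 \<noteq> 0" "dser g 2 \<noteq> 0"
      using dser_moebius_mult[OF h, of 2] dser_moebius_mult[OF g, of 2] by auto
    then show "G 2 \<noteq> 0" using P_eq[of 2] by (simp add: G_def)
  qed auto
  then have "abs_conv_at (\<lambda>n. mangoldt n * h n) 1"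
    unfolding h_def c_def using \<psi>(2) by (intro mangoldt_conv_imp_principal_conv g) (auto simp: norm_g)
  then show False
    using mangoldt_principal_not_summable[OF h E0(3,1) dser_h] by blast
qed

section \<open>Dirichlet characters\<close>

definition dirichlet_char :: "nat \<Rightarrow> (nat \<Rightarrow> complex) \<Rightarrow> bool" where
  "dirichlet_char q \<psi> \<longleftrightarrow> (\<forall>m n. \<psi> (m * n) = \<psi> m * \<psi> n) \<and>
    (\<forall>m n. [m = n] (mod q) \<longrightarrow> \<psi> m = \<psi> n) \<and> (\<forall>n. \<psi> n \<noteq> 0 \<longleftrightarrow> coprime n q)"

text \<open>A character on the subgroup of units modulo \<open>q\<close> whose representatives form \<open>H\<close>.\<close>

definition partial_char :: "nat \<Rightarrow> nat set \<Rightarrow> (nat \<Rightarrow> complex) \<Rightarrow> bool" where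
  "partial_char q H f \<longleftrightarrow> 1 \<in> H \<and> (\<forall>m\<in>H. \<forall>n\<in>H. m * n \<in> H \<and> f (m * n) = f m * f n) \<and>
    (\<forall>m n. [m = n] (mod q) \<longrightarrow> m \<in> H \<longrightarrow> n \<in> H \<and> f m = f n) \<and> (\<forall>n\<in>H. coprime n q \<and> f n \<noteq> 0)"

lemma partial_charD:
  assumes "partial_char q H f"
  shows "1 \<in> H" "m \<in> H \<Longrightarrow> n \<in> H \<Longrightarrow> m * n \<in> H" "m \<in> H \<Longrightarrow> n \<in> H \<Longrightarrow> f (m * n) = f m * f n"
    "[m = n] (mod q) \<Longrightarrow> m \<in> H \<Longrightarrow> n \<in> H" "[m = n] (mod q) \<Longrightarrow> m \<in> H \<Longrightarrow> f m = f n"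
    "n \<in> H \<Longrightarrow> coprime n q" "n \<in> H \<Longrightarrow> f n \<noteq> 0"
  using assms unfolding partial_char_def by blast+

lemma partial_char_1:
  assumes "partial_char q H f"
  shows "f 1 = 1"
  using partial_charD(3)[OF assms, of 1 1] partial_charD(1,7)[OF assms] by auto

lemma partial_char_power:
  assumes "partial_char q H f" "n \<in> H"
  shows "n ^ k \<in> H \<and> f (n ^ k) = f n ^ k"
  by (induction k) (use assms partial_charD[OF assms(1)] partial_char_1[OF assms(1)] in auto)

lemma partial_char_inverse:
  assumes "partial_char q H f" "n \<in> H" "q > 0"
  obtains m where "m \<in> H" "[m * n = 1] (mod q)"
proof
  show "n ^ (totient q - 1) \<in> H" using partial_char_power assms by blast
  have "n ^ (totient q - 1) * n = n ^ totient q"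
    using assms(3) by (simp flip: power_Suc2)
  then show "[n ^ (totient q - 1) * n = 1] (mod q)"
    using euler_theorem[of n q] partial_charD(6)[OF assms(1,2)] by simp
qed

text \<open>\<open>r\<close> is the order of \<open>x\<close> modulo \<open>H\<close>, and
  \<open>x\<close> may be sent to any \<open>r\<close>-th root \<open>w\<close> of
  \<open>f (x ^ r)\<close> by \<open>f' (h * x ^ j) = f h * w ^ j\<close>. The work lies in
  independence of the representation.\<close>

lemma partial_char_extend:
  assumes f: "partial_char q H f" and q: "q > 0" and x: "coprime x q"
    and r: "r = (LEAST r. r > 0 \<and> x ^ r \<in> H)" and w: "w ^ r = f (x ^ r)"
  obtains H' f' where "partial_char q H' f'" "H \<subseteq> H'" "x \<in> H'" "f' x = w" "\<And>n. n \<in> H \<Longrightarrow> f' n = f n"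
proof -
  note H = partial_charD[OF f]
  have "x ^ totient q \<in> H"
    using H(4)[of 1 "x ^ totient q"] H(1) euler_theorem[OF x] by (simp add: cong_sym_eq)
  then have r0: "r > 0" and xr: "x ^ r \<in> H"
    unfolding r using LeastI[of "\<lambda>r. r > 0 \<and> x ^ r \<in> H" "totient q"] q by auto
  have w0: "w \<noteq> 0" using w H(7)[OF xr] r0 by (auto simp: zero_power)
  \<comment> \<open>Division with remainder: \<open>x ^ (e mod r)\<close> lies in \<open>H\<close>
    too, so minimality of \<open>r\<close> forces \<open>r\<close> to divide
    \<open>e\<close>.\<close>
  have power_in_H: "f (x ^ e) = w ^ e" if e: "x ^ e \<in> H" for e
  proof -
    obtain y where y: "y \<in> H" "[y * x ^ (r * (e div r)) = 1] (mod q)"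
      using partial_char_inverse[OF f _ q] partial_char_power[OF f xr, of "e div r"] by (auto simp: power_mult)
    have split: "y * x ^ e = y * x ^ (r * (e div r)) * x ^ (e mod r)"
      by (simp flip: power_add mult.assoc add: mult.assoc)
    have "[y * x ^ e = x ^ (e mod r)] (mod q)"
      unfolding split using cong_mult[OF y(2) cong_refl[of "x ^ (e mod r)"]] by (simp only: mult_1)
    then have "x ^ (e mod r) \<in> H" using H(2)[OF y(1) e] H(4) by blast
    moreover have "e mod r < r" using r0 by simp
    ultimately have "e mod r = 0"
      using not_less_Least[of "e mod r" "\<lambda>r. r > 0 \<and> x ^ r \<in> H"] r by auto
    then obtain k where e_eq: "e = r * k" by (auto simp: mod_eq_0_iff_dvd)
    show ?thesis
      unfolding e_eq power_mult using partial_char_power[OF f xr] w by simp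
  qed
  \<comment> \<open>For \<open>i <= j\<close> the power \<open>x ^ i\<close> cancels, which puts
    \<open>x ^ (j - i)\<close> into \<open>H\<close>, where \<open>power_in_H\<close>
    applies.\<close>
  have unique_le: "f h1 * w ^ i = f h2 * w ^ j"
    if h: "h1 \<in> H" "h2 \<in> H" "[h1 * x ^ i = h2 * x ^ j] (mod q)" "i \<le> j" for h1 h2 i j
  proof -
    have "[h1 * x ^ i = h2 * x ^ (j - i) * x ^ i] (mod q)"
      using h(3,4) by (simp add: mult.assoc flip: power_add)
    then have cong: "[h1 = h2 * x ^ (j - i)] (mod q)"
      using x cong_mult_rcancel_nat[of "x ^ i" q h1 "h2 * x ^ (j - i)"] by simp
    obtain y where y: "y \<in> H" "[y * h2 = 1] (mod q)"
      using partial_char_inverse[OF f h(2) q] by blast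
    have "[y * h1 = y * h2 * x ^ (j - i)] (mod q)"
      using cong_mult[OF cong_refl[of y] cong] by (simp add: mult.assoc)
    also have "[y * h2 * x ^ (j - i) = x ^ (j - i)] (mod q)"
      using cong_mult[OF y(2) cong_refl[of "x ^ (j - i)"]] by simp
    finally have xH: "x ^ (j - i) \<in> H" using H(2)[OF y(1) h(1)] H(4) by blast
    have "f h1 = f h2 * w ^ (j - i)"
      using H(5)[OF cong h(1)] H(3)[OF h(2) xH] power_in_H[OF xH] by simp
    then show ?thesis using h(4) by (simp add: mult.assoc flip: power_add)
  qed
  have unique: "f h1 * w ^ i = f h2 * w ^ j"
    if "h1 \<in> H" "h2 \<in> H" "[h1 * x ^ i = h2 * x ^ j] (mod q)" for h1 h2 i j
    using unique_le[of h1 h2 i j] unique_le[of h2 h1 j i] that by (metis cong_sym nat_le_linear)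
  define H' where "H' = {n. \<exists>h\<in>H. \<exists>j. [n = h * x ^ j] (mod q)}"
  define f' where "f' n = (THE v. \<exists>h\<in>H. \<exists>j. [n = h * x ^ j] (mod q) \<and> v = f h * w ^ j)" for n
  have f': "f' n = f h * w ^ j" if n: "h \<in> H" "[n = h * x ^ j] (mod q)" for n h j
    unfolding f'_def
  proof (rule the_equality)
    show "\<exists>h'\<in>H. \<exists>j'. [n = h' * x ^ j'] (mod q) \<and> f h * w ^ j = f h' * w ^ j'" using n by blast
    fix v assume "\<exists>h\<in>H. \<exists>j. [n = h * x ^ j] (mod q) \<and> v = f h * w ^ j"
    then obtain h' j' where "h' \<in> H" "[n = h' * x ^ j'] (mod q)" "v = f h' * w ^ j'" by blast
    then show "v = f h * w ^ j" using unique[of h' h j' j] n by (metis cong_sym cong_trans)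
  qed
  show ?thesis
  proof (rule that[of H' f'])
    show ext: "f' n = f n" if "n \<in> H" for n using f'[of n n 0] that by simp
    show "H \<subseteq> H'"
    proof
      fix n assume "n \<in> H"
      then show "n \<in> H'" unfolding H'_def by (auto intro!: bexI[of _ n] exI[of _ 0])
    qed
    show "x \<in> H'" unfolding H'_def using H(1) by (auto intro!: bexI[of _ 1] exI[of _ 1])
    show "f' x = w" using f'[of 1 x 1] H(1) partial_char_1[OF f] by simp
    show "partial_char q H' f'"
      unfolding partial_char_def
    proof (intro conjI ballI allI impI)
      show "1 \<in> H'" using \<open>H \<subseteq> H'\<close> H(1) by blast
    next
      fix m n assume "m \<in> H'" "n \<in> H'"
      then obtain h i k j where m: "h \<in> H" "[m = h * x ^ i] (mod q)" and n: "k \<in> H" "[n = k * x ^ j] (mod q)"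
        by (auto simp: H'_def)
      have mn: "[m * n = (h * k) * x ^ (i + j)] (mod q)"
        using cong_mult[OF m(2) n(2)] by (simp add: power_add mult_ac)
      have hk: "h * k \<in> H" using H(2) m n by blast
      show "m * n \<in> H'" unfolding H'_def using mn hk by blast
      show "f' (m * n) = f' m * f' n"
        unfolding f'[OF hk mn] f'[OF m] f'[OF n] H(3)[OF m(1) n(1)] by (simp add: power_add)
    next
      fix m n assume "[m = n] (mod q)" "m \<in> H'"
      then obtain h i where m: "h \<in> H" "[m = h * x ^ i] (mod q)" by (auto simp: H'_def)
      have n: "[n = h * x ^ i] (mod q)" using m(2) \<open>[m = n] (mod q)\<close> cong_sym cong_trans by blast
      then show "n \<in> H'" "f' m = f' n" using m f'[OF m] f'[OF m(1) n] by (auto simp: H'_def)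
    next
      fix n assume "n \<in> H'"
      then obtain h i where n: "h \<in> H" "[n = h * x ^ i] (mod q)" by (auto simp: H'_def)
      have "coprime (h * x ^ i) q" using x H(6)[OF n(1)] by simp
      then show "coprime n q" using cong_imp_coprime[OF cong_sym[OF n(2)]] by blast
      show "f' n \<noteq> 0" using f'[OF n] H(7)[OF n(1)] w0 by simp
    qed
  qed
qed

text \<open>Induction on the number of units below \<open>q\<close> outside \<open>H\<close>.
  Nonzero complex numbers have \<open>r\<close>-th roots, so a missing unit can always be
  adjoined.\<close>

lemma partial_char_extend_full:
  assumes "partial_char q H f" "q > 0"
  shows "\<exists>\<psi>. dirichlet_char q \<psi> \<and> (\<forall>n\<in>H. \<psi> n = f n)"
  using assms
proof (induction "card ({n. n < q \<and> coprime n q} - H)" arbitrary: H f rule: less_induct)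
  case less
  note f = \<open>partial_char q H f\<close>
  show ?case
  proof (cases "\<exists>x. coprime x q \<and> x \<notin> H")
    case False
    then have H: "n \<in> H \<longleftrightarrow> coprime n q" for n using partial_charD(6)[OF f] by blast
    have "coprime m q \<longleftrightarrow> coprime n q" if "[m = n] (mod q)" for m n
      using that cong_imp_coprime cong_sym by blast
    then have "dirichlet_char q (\<lambda>n. if coprime n q then f n else 0)"
      using partial_charD(3,5,7)[OF f] unfolding dirichlet_char_def H by auto
    then show ?thesis using H by (intro exI[of _ "\<lambda>n. if coprime n q then f n else 0"]) auto
  next
    case True
    then obtain x where x: "coprime x q" "x \<notin> H" by blast
    define r where "r = (LEAST r. r > 0 \<and> x ^ r \<in> H)"
    have "x ^ totient q \<in> H"
      using partial_charD(4)[OF f, of 1 "x ^ totient q"] partial_charD(1)[OF f] euler_theorem[OF x(1)]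
      by (simp add: cong_sym_eq)
    then have "r > 0"
      unfolding r_def using LeastI[of "\<lambda>r. r > 0 \<and> x ^ r \<in> H" "totient q"] less.prems(2) by auto
    moreover have "x ^ r \<in> H"
      unfolding r_def using LeastI[of "\<lambda>r. r > 0 \<and> x ^ r \<in> H" "totient q"] less.prems(2)
        \<open>x ^ totient q \<in> H\<close> by auto
    ultimately have "exp (ln (f (x ^ r)) / of_nat r) ^ r = f (x ^ r)"
      using partial_charD(7)[OF f, of "x ^ r"] by (simp flip: exp_of_nat_mult)
    then obtain H' f' where H': "partial_char q H' f'" "H \<subseteq> H'" "x \<in> H'" "\<And>n. n \<in> H \<Longrightarrow> f' n = f n"
      using partial_char_extend[OF f less.prems(2) x(1) r_def] by blast
    \<comment> \<open>The count runs over representatives below \<open>q\<close>, so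
      \<open>x mod q\<close> witnesses the strict decrease; \<open>H\<close> and \<open>H'\<close>
      are unions of residue classes.\<close>
    have "x mod q \<in> {n. n < q \<and> coprime n q}" using x(1) less.prems(2) by simp
    moreover have "x mod q \<notin> H" using x(2) partial_charD(4)[OF f, of "x mod q" x] by auto
    moreover have "x mod q \<in> H'" using partial_charD(4)[OF H'(1), of x "x mod q"] H'(3) by (simp add: cong_def)
    ultimately have "{n. n < q \<and> coprime n q} - H' \<subset> {n. n < q \<and> coprime n q} - H" using H'(2) by blast
    then have "card ({n. n < q \<and> coprime n q} - H') < card ({n. n < q \<and> coprime n q} - H)"
      by (intro psubset_card_mono) auto
    from less.hyps[OF this H'(1) less.prems(2)] show ?thesis using H'(2,4) by (metis subsetD)
  qed
qed

lemma partial_char_trivial: "q > 0 \<Longrightarrow> partial_char q {n. [n = 1] (mod q)} (\<lambda>_. 1)"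
  unfolding partial_char_def
proof (intro conjI ballI allI impI)
  show "coprime n q" if "n \<in> {n. [n = 1] (mod q)}" for n
    using that cong_imp_coprime[of 1 n q] by (auto simp: cong_sym_eq)
qed (auto intro: cong_trans cong_sym dest: cong_mult)

text \<open>Over the trivial subgroup the order \<open>r\<close> of \<open>a\<close> exceeds 1, so a
  primitive \<open>r\<close>-th root of unity can be prescribed at \<open>a\<close>; the result then
  extends to all units.\<close>

lemma dirichlet_char_separates:
  assumes "q > 0" "coprime a q" "\<not> [a = 1] (mod q)"
  obtains \<psi> where "dirichlet_char q \<psi>" "\<psi> a \<noteq> 1"
proof -
  define H where "H = {n. [n = 1] (mod q)}"
  have f: "partial_char q H (\<lambda>_. 1)" unfolding H_def by (rule partial_char_trivial[OF assms(1)])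
  define r where "r = (LEAST r. r > 0 \<and> a ^ r \<in> H)"
  have "r > 0 \<and> a ^ r \<in> H"
    unfolding r_def using euler_theorem[OF assms(2)] assms(1)
    by (intro LeastI[of "\<lambda>r. r > 0 \<and> a ^ r \<in> H" "totient q"]) (auto simp: H_def)
  then have "r > 0" "r \<noteq> 1" using assms(3) by (auto simp: H_def)
  define w where "w = exp (2 * of_real pi * \<i> * of_nat 1 / of_nat r)"
  have "w ^ r = 1" "w \<noteq> 1"
    unfolding w_def using complex_root_unity[of r 1] complex_root_unity_eq_1[of r 1] \<open>r > 0\<close> \<open>r \<noteq> 1\<close> by auto
  then obtain H' f' where H': "partial_char q H' f'" "a \<in> H'" "f' a = w"
    using partial_char_extend[OF f assms(1,2) r_def \<open>w ^ r = 1\<close>] by blast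
  obtain \<psi> where "dirichlet_char q \<psi>" "\<psi> a = w"
    using partial_char_extend_full[OF H'(1) assms(1)] H'(2,3) by auto
  then show ?thesis using that \<open>w \<noteq> 1\<close> by blast
qed

section \<open>Finiteness and orthogonality of the characters\<close>

lemma dirichlet_charD:
  assumes "dirichlet_char q \<psi>"
  shows "\<psi> (m * n) = \<psi> m * \<psi> n" "[m = n] (mod q) \<Longrightarrow> \<psi> m = \<psi> n" "\<psi> n \<noteq> 0 \<longleftrightarrow> coprime n q"
  using assms unfolding dirichlet_char_def by blast+

lemma dirichlet_char_1: "dirichlet_char q \<psi> \<Longrightarrow> \<psi> 1 = 1"
  using dirichlet_charD(1)[of q \<psi> 1 1] dirichlet_charD(3)[of q \<psi> 1] by simp

lemma dirichlet_char_power: "dirichlet_char q \<psi> \<Longrightarrow> \<psi> (n ^ k) = \<psi> n ^ k"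
  by (induction k) (use dirichlet_char_1 in \<open>auto simp: dirichlet_charD(1)\<close>)

lemma dirichlet_char_root_of_unity:
  assumes "dirichlet_char q \<psi>" "coprime n q"
  shows "\<psi> n ^ totient q = 1"
  using dirichlet_char_power[OF assms(1), of n "totient q"] dirichlet_charD(2)[OF assms(1) euler_theorem[OF assms(2)]]
    dirichlet_char_1[OF assms(1)] by simp

lemma norm_dirichlet_char:
  assumes "dirichlet_char q \<psi>" "q > 0"
  shows "norm (\<psi> n) = (if coprime n q then 1 else 0)"
proof (cases "coprime n q")
  case True
  have "norm (\<psi> n) ^ totient q = 1"
    using dirichlet_char_root_of_unity[OF assms(1) True] by (metis norm_one norm_power)
  then show ?thesis using True assms(2) power_eq_imp_eq_base[of "norm (\<psi> n)" "totient q" 1] by simp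
qed (use dirichlet_charD(3)[OF assms(1), of n] in auto)

text \<open>By periodicity the values below \<open>q\<close> determine the character, and each is 0
  or a \<open>totient q\<close>-th root of unity.\<close>

lemma finite_dirichlet_chars:
  assumes "q > 0"
  shows "finite {\<psi>. dirichlet_char q \<psi>}"
proof -
  define R where "R = {z::complex. z ^ totient q = 1} \<union> {0}"
  have "finite R" unfolding R_def using assms finite_roots_unity[of "totient q", where ?'a = complex]
    by (simp add: Suc_le_eq)
  have "inj_on (\<lambda>\<psi>. restrict \<psi> {..<q}) {\<psi>. dirichlet_char q \<psi>}"
  proof (rule inj_onI, rule ext, unfold mem_Collect_eq)
    fix \<psi>1 \<psi>2 n assume \<psi>: "dirichlet_char q \<psi>1" "dirichlet_char q \<psi>2" "restrict \<psi>1 {..<q} = restrict \<psi>2 {..<q}"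
    have "\<psi>1 (n mod q) = \<psi>2 (n mod q)"
      using fun_cong[OF \<psi>(3), of "n mod q"] assms by simp
    then show "\<psi>1 n = \<psi>2 n"
      using dirichlet_charD(2)[OF \<psi>(1), of n "n mod q"] dirichlet_charD(2)[OF \<psi>(2), of n "n mod q"]
      by (simp add: cong_def)
  qed
  moreover have "(\<lambda>\<psi>. restrict \<psi> {..<q}) ` {\<psi>. dirichlet_char q \<psi>} \<subseteq> {..<q} \<rightarrow>\<^sub>E R"
  proof (rule image_subsetI)
    fix \<psi> assume "\<psi> \<in> {\<psi>. dirichlet_char q \<psi>}"
    then have "\<psi> n \<in> R" for n
      using dirichlet_char_root_of_unity[of q \<psi> n] dirichlet_charD(3)[of q \<psi> n] by (auto simp: R_def)
    then show "restrict \<psi> {..<q} \<in> {..<q} \<rightarrow>\<^sub>E R" by auto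
  qed
  moreover have "finite ({..<q} \<rightarrow>\<^sub>E R)" using \<open>finite R\<close> by (intro finite_PiE) auto
  ultimately show ?thesis by (rule inj_on_finite)
qed

text \<open>If \<open>b\<close> is not 1 modulo \<open>q\<close>, multiplication by a character with
  value other than 1 at \<open>b\<close> permutes the characters and multiplies the sum by this
  value.\<close>

lemma sum_dirichlet_chars:
  assumes q: "q > 0" and b: "coprime b q"
  shows "(\<Sum>\<psi> | dirichlet_char q \<psi>. \<psi> b) = (if [b = 1] (mod q) then of_nat (card {\<psi>. dirichlet_char q \<psi>}) else 0)"
proof (cases "[b = 1] (mod q)")
  case True
  then have "\<psi> b = 1" if "dirichlet_char q \<psi>" for \<psi>
    using dirichlet_charD(2)[OF that True] dirichlet_char_1[OF that] by simp
  then have "(\<Sum>\<psi> | dirichlet_char q \<psi>. \<psi> b) = (\<Sum>\<psi> | dirichlet_char q \<psi>. 1)" by (intro sum.cong) auto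
  then show ?thesis using True by simp
next
  case False
  let ?D = "{\<psi>. dirichlet_char q \<psi>}"
  obtain \<psi>1 where \<psi>1: "dirichlet_char q \<psi>1" "\<psi>1 b \<noteq> 1"
    using dirichlet_char_separates[OF q b False] by blast
  define m where "m \<psi> n = \<psi>1 n * \<psi> n" for \<psi> n
  have maps: "m ` ?D \<subseteq> ?D"
    using \<psi>1(1) unfolding dirichlet_char_def m_def by fastforce
  have inj: "inj_on m ?D"
  proof (rule inj_onI, rule ext, unfold mem_Collect_eq)
    fix \<psi> \<psi>' n assume \<psi>: "dirichlet_char q \<psi>" "dirichlet_char q \<psi>'" "m \<psi> = m \<psi>'"
    show "\<psi> n = \<psi>' n"
      using fun_cong[OF \<psi>(3), of n] dirichlet_charD(3)[OF \<psi>1(1), of n]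
        dirichlet_charD(3)[OF \<psi>(1), of n] dirichlet_charD(3)[OF \<psi>(2), of n]
      by (auto simp: m_def)
  qed
  have "m ` ?D = ?D" by (rule endo_inj_surj[OF finite_dirichlet_chars[OF q] maps inj])
  then have "(\<Sum>\<psi>\<in>?D. \<psi> b) = (\<Sum>\<psi>\<in>?D. m \<psi> b)"
    using sum.reindex[OF inj, of "\<lambda>\<psi>. \<psi> b"] by simp
  also have "\<dots> = \<psi>1 b * (\<Sum>\<psi>\<in>?D. \<psi> b)" by (simp add: m_def sum_distrib_left)
  finally show ?thesis using \<psi>1(2) False by auto
qed

lemma exists_dirichlet_char:
  assumes "q > 0"
  shows "\<exists>\<psi>. dirichlet_char q \<psi>"
  using partial_char_extend_full[OF partial_char_trivial[OF assms] assms] by blast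

section \<open>Convergence of the twisted Moebius series\<close>

text \<open>After subtraction of the mean a full period sums to 0, so the partial sums are
  themselves periodic and take finitely many values.\<close>

lemma periodic_partial_sums_bounded:
  fixes a :: "nat \<Rightarrow> complex"
  assumes q: "q > 0" and a: "\<And>n. a (n + q) = a n"
  shows "\<exists>C. \<forall>N. norm ((\<Sum>k=1..N. a k) - (\<Sum>k<q. a k) / of_nat q * of_nat N) \<le> C"
proof -
  define A where "A = (\<Sum>k<q. a k) / of_nat q"
  define S where "S N = (\<Sum>k<N. a k - A)" for N
  have S_q: "S q = 0" using q by (simp add: S_def A_def sum_subtractf)
  have shift: "S (N + q) = S N" for N
    by (induction N) (auto simp: S_q a S_def[of 0], simp add: S_def a)
  have "S (N + k * q) = S N" for N k
  proof (induction k)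
    case (Suc k)
    then show ?case using shift[of "N + k * q"] by (simp add: add_ac)
  qed simp
  from this[of "n mod q" "n div q" for n] have mod: "S N = S (N mod q)" for N by (metis mod_div_mult_eq)
  have "norm (S N) \<le> (\<Sum>k<q. norm (S k))" for N
    unfolding mod[of N] using q by (intro member_le_sum) auto
  moreover have "(\<Sum>k=1..N. a k) - A * of_nat N = S (Suc N) - (a 0 - A)" for N
    by (induction N) (auto simp: S_def algebra_simps)
  ultimately have "norm ((\<Sum>k=1..N. a k) - A * of_nat N) \<le> (\<Sum>k<q. norm (S k)) + norm (a 0 - A)" for N
    using norm_triangle_ineq4[of "S (Suc N)" "a 0 - A"] by (metis add_le_cancel_right order_trans)
  then show ?thesis unfolding A_def by blast
qed

lemma open_nonzero_set:
  assumes "f holomorphic_on S" "open S"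
  shows "open {s \<in> S. f s \<noteq> (0 :: complex)}"
proof -
  have "open (S \<inter> f -` (- {0}))"
    using holomorphic_on_imp_continuous_on[OF assms(1)] assms(2) by (rule continuous_open_preimage) auto
  also have "S \<inter> f -` (- {0}) = {s \<in> S. f s \<noteq> 0}" by auto
  finally show ?thesis .
qed

text \<open>The mean \<open>A\<close> of \<open>\<psi>\<close> over a period is the residue of
  \<open>L\<close> at 1, and the sum is the value of \<open>1 / L\<close> there. The implication
  records that a pole of \<open>L\<close> turns this value into 0.\<close>

theorem moebius_char_sums:
  assumes \<psi>: "dirichlet_char q \<psi>" and q: "q > 0"
  shows "\<exists>c. (\<lambda>n. of_int (moebius_mu n) * \<psi> n / of_nat n) sums c \<and> ((\<Sum>k<q. \<psi> k) \<noteq> 0 \<longrightarrow> c = 0)"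
proof -
  let ?H = "{s. Re s > 0}"
  have H: "open ?H" by (rule open_halfspace_Re_gt)
  have norm_\<psi>: "norm (\<psi> n) \<in> {0, 1}" for n using norm_dirichlet_char[OF \<psi> q, of n] by auto
  then have norm_le: "norm (\<psi> n) \<le> 1" for n by (smt (verit) insertE singletonD)
  have g: "bdd_compl_mult \<psi>"
    using dirichlet_char_1[OF \<psi>] dirichlet_charD(1)[OF \<psi>] norm_le by (auto simp: bdd_compl_mult_def)
  have per: "\<psi> (n + q) = \<psi> n" for n by (rule dirichlet_charD(2)[OF \<psi>]) (simp add: cong_def)
  define A where "A = (\<Sum>k<q. \<psi> k) / of_nat q"
  define A0 where "A0 = (\<Sum>k<q. of_real (norm (\<psi> k))) / (of_nat q :: complex)"
  have "(\<Sum>k<q. norm (\<psi> k)) > 0"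
  proof (rule sum_pos2)
    have "\<psi> (1 mod q) = 1" using dirichlet_charD(2)[OF \<psi>, of "1 mod q" 1] dirichlet_char_1[OF \<psi>] by (simp add: cong_def)
    then show "norm (\<psi> (1 mod q)) > 0" by simp
  qed (use q in auto)
  then have "A0 \<noteq> 0" using q unfolding A0_def by (simp flip: of_real_sum)
  obtain C where C: "\<And>N. norm ((\<Sum>k=1..N. \<psi> k) - A * of_nat N) \<le> C"
    using periodic_partial_sums_bounded[of q \<psi>] q per unfolding A_def by blast
  obtain E where E: "E holomorphic_on ?H" "\<And>s. Re s > 1 \<Longrightarrow> dser \<psi> s = A / (s - 1) + E s"
    using dser_continuation[OF C norm_le] by blast
  obtain C0 where C0: "\<And>N. norm ((\<Sum>k=1..N. of_real (norm (\<psi> k))) - A0 * of_nat N) \<le> C0"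
    using periodic_partial_sums_bounded[of q "\<lambda>k. of_real (norm (\<psi> k))"] q per unfolding A0_def by auto
  obtain E0 where E0: "E0 holomorphic_on ?H"
      "\<And>s. Re s > 1 \<Longrightarrow> dser (\<lambda>n. of_real (norm (\<psi> n))) s = A0 / (s - 1) + E0 s"
    using dser_continuation[OF C0, of 1] norm_le by auto
  have nonzero: "A / (s - 1) + E s \<noteq> 0" if s: "Re s \<ge> 1" "A = 0 \<or> s \<noteq> 1" for s
  proof (cases "Re s = 1")
    case True
    then have s_eq: "s = 1 + \<i> * of_real (Im s)" by (simp add: complex_eq_iff)
    have "A = 0 \<or> Im s \<noteq> 0" using s(2) True by (auto simp: complex_eq_iff)
    from dser_nonvanishing[OF g norm_\<psi> E0 \<open>A0 \<noteq> 0\<close> E this] show ?thesis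
      by (subst (1 2) s_eq) simp
  next
    case False
    then have "Re s > 1" using s by simp
    then show ?thesis using dser_moebius_mult[OF g, of s] E(2)[of s] by auto
  qed
  have le1: "norm (of_int (moebius_mu n) * \<psi> n) \<le> 1" for n
    using abs_moebius_mu_le_1[of n] norm_le[of n] mult_mono[of "\<bar>real_of_int (moebius_mu n)\<bar>" 1 "norm (\<psi> n)" 1]
    by (simp add: norm_mult)
  have "\<exists>V F. open V \<and> {s. Re s \<ge> 1} \<subseteq> V \<and> F holomorphic_on V \<and>
      (\<forall>s. Re s > 1 \<longrightarrow> F s * (A / (s - 1) + E s) = 1) \<and> (A \<noteq> 0 \<longrightarrow> F 1 = 0)"
  proof (cases "A = 0")
    case True
    then show ?thesis
      using nonzero E(1) H
      by (intro exI[of _ "{s \<in> ?H. E s \<noteq> 0}"] exI[of _ "\<lambda>s. 1 / E s"] conjI open_nonzero_set)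
         (auto intro!: holomorphic_intros intro: holomorphic_on_subset)
  next
    case False
    \<comment> \<open>\<open>Z\<close> is \<open>(s - 1) * L\<close> with the pole removed and
      \<open>Z 1 = A\<close>, so \<open>(s - 1) / Z\<close> extends \<open>1 / L\<close> to 1 with
      value 0.\<close>
    define Z where "Z s = A + (s - 1) * E s" for s
    have Z: "Z holomorphic_on ?H" unfolding Z_def by (intro holomorphic_intros E(1))
    have Z_eq: "Z s = (s - 1) * (A / (s - 1) + E s)" if "s \<noteq> 1" for s
      using that by (simp add: Z_def field_simps)
    have "Z s \<noteq> 0" if "Re s \<ge> 1" for s
      using nonzero[OF that] Z_eq[of s] False by (cases "s = 1") (auto simp: Z_def)
    moreover have "(s - 1) / Z s * (A / (s - 1) + E s) = 1" if "Re s > 1" for s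
    proof -
      have "s \<noteq> 1" using that by auto
      then show ?thesis using nonzero[of s] that Z_eq[of s] by simp
    qed
    moreover have "(\<lambda>s. (s - 1) / Z s) holomorphic_on {s \<in> ?H. Z s \<noteq> 0}"
      using Z by (intro holomorphic_intros) (auto intro: holomorphic_on_subset)
    ultimately show ?thesis
      using Z H
      by (intro exI[of _ "{s \<in> ?H. Z s \<noteq> 0}"] exI[of _ "\<lambda>s. (s - 1) / Z s"] conjI open_nonzero_set) auto
  qed
  then obtain V F where F: "open V" "{s. Re s \<ge> 1} \<subseteq> V" "F holomorphic_on V"
      "\<And>s. Re s > 1 \<Longrightarrow> F s * (A / (s - 1) + E s) = 1" "A \<noteq> 0 \<Longrightarrow> F 1 = 0"
    by auto
  have "(\<lambda>n. of_int (moebius_mu n) * \<psi> n / of_nat n) sums F 1"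
  proof (rule newman_tauberian[OF le1 F(1-3)])
    fix s :: complex assume s: "Re s > 1"
    have eq: "dser (\<lambda>n. of_int (moebius_mu n) * \<psi> n) s * (A / (s - 1) + E s) = F s * (A / (s - 1) + E s)"
      using dser_moebius_mult[OF g s] E(2)[OF s] F(4)[OF s] by simp
    have "A / (s - 1) + E s \<noteq> 0" using F(4)[OF s] by auto
    from mult_right_cancel[OF this] eq show "dser (\<lambda>n. of_int (moebius_mu n) * \<psi> n) s = F s" by blast
  qed
  moreover have "A \<noteq> 0" if "(\<Sum>k<q. \<psi> k) \<noteq> 0" using that q by (simp add: A_def)
  ultimately show ?thesis using F(5) by blast
qed

lemma moebius_coprime_sums_0:
  assumes "q > 0"
  shows "(\<lambda>n. of_int (moebius_mu n) * (if coprime n q then 1 else 0) / of_nat n) sums (0 :: complex)"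
proof -
  define \<psi> where "\<psi> n = (if coprime n q then 1 else 0 :: complex)" for n
  have "coprime m q \<longleftrightarrow> coprime n q" if "[m = n] (mod q)" for m n
    using that cong_imp_coprime cong_sym by blast
  then have "dirichlet_char q \<psi>" by (auto simp: dirichlet_char_def \<psi>_def)
  moreover have "(\<Sum>k<q. \<psi> k) \<noteq> 0"
  proof -
    have "(\<Sum>k<q. \<psi> k) = of_nat (card {k \<in> {..<q}. coprime k q})"
      unfolding \<psi>_def by (simp add: sum.If_cases Int_def)
    moreover have "1 mod q \<in> {k \<in> {..<q}. coprime k q}" using assms by simp
    then have "card {k \<in> {..<q}. coprime k q} \<noteq> 0" by (subst card_0_eq) auto
    ultimately show ?thesis by simp
  qed
  ultimately show ?thesis using moebius_char_sums[OF _ assms, of \<psi>] by (auto simp: \<psi>_def)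
qed

text \<open>With \<open>b r\<close> inverse to \<open>r\<close> modulo \<open>q\<close>, the sum of
  \<open>\<psi> (b r * n)\<close> over all characters detects \<open>n = r\<close> modulo
  \<open>q\<close>. Thus \<open>h\<close> on the units is a finite combination of characters, each
  with a convergent series.\<close>

lemma summable_moebius_coprime_periodic:
  fixes h :: "nat \<Rightarrow> complex"
  assumes q: "q > 0" and h: "\<And>m n. [m = n] (mod q) \<Longrightarrow> h m = h n"
  shows "summable (\<lambda>n. of_int (moebius_mu n) * (if coprime n q then h n else 0) / of_nat n)"
proof -
  let ?D = "{\<psi>. dirichlet_char q \<psi>}"
  define d where "d = (of_nat (card ?D) :: complex)"
  have d: "d \<noteq> 0"
    using exists_dirichlet_char[OF q] finite_dirichlet_chars[OF q] by (auto simp: d_def card_eq_0_iff)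
  define U where "U = {r. r < q \<and> coprime r q}"
  have U: "finite U" by (simp add: U_def)
  have "\<exists>b. [b * r = 1] (mod q)" if "r \<in> U" for r
    using that cong_solve_coprime_nat[of r q] by (auto simp: U_def mult.commute)
  then obtain b where b: "\<And>r. r \<in> U \<Longrightarrow> [b r * r = 1] (mod q)" by metis
  have expand: "(if coprime n q then h n else 0) = (\<Sum>r\<in>U. h r / d * (\<Sum>\<psi>\<in>?D. \<psi> (b r) * \<psi> n))" for n
  proof -
    have inner: "(\<Sum>\<psi>\<in>?D. \<psi> (b r) * \<psi> n) = (if r = n mod q \<and> coprime n q then d else 0)" if r: "r \<in> U" for r
    proof -
      have eq: "(\<Sum>\<psi>\<in>?D. \<psi> (b r) * \<psi> n) = (\<Sum>\<psi>\<in>?D. \<psi> (b r * n))"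
        by (intro sum.cong) (auto simp: dirichlet_charD(1))
      show ?thesis
      proof (cases "coprime n q")
        case True
        have "coprime (b r * r) q" using cong_imp_coprime[OF cong_sym[OF b[OF r]]] by simp
        then have br: "coprime (b r) q" by simp
        have "[b r * n = 1] (mod q) \<longleftrightarrow> [b r * n = b r * r] (mod q)"
          using b[OF r] by (metis cong_sym cong_trans)
        also have "\<dots> \<longleftrightarrow> [n = r] (mod q)" by (rule cong_mult_lcancel_nat[OF br])
        also have "\<dots> \<longleftrightarrow> r = n mod q" using r by (auto simp: cong_def U_def)
        finally show ?thesis
          unfolding eq using sum_dirichlet_chars[OF q, of "b r * n"] br True by (simp add: d_def)
      next
        case False
        then have "\<psi> n = 0" if "\<psi> \<in> ?D" for \<psi> using that dirichlet_charD(3) by blast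
        then have "(\<Sum>\<psi>\<in>?D. \<psi> (b r) * \<psi> n) = 0" by (intro sum.neutral) auto
        then show ?thesis using False by simp
      qed
    qed
    have "(\<Sum>r\<in>U. h r / d * (\<Sum>\<psi>\<in>?D. \<psi> (b r) * \<psi> n)) = (\<Sum>r\<in>U. if r = n mod q then (if coprime n q then h r else 0) else 0)"
      using d by (intro sum.cong) (auto simp: inner)
    also have "\<dots> = (if n mod q \<in> U then (if coprime n q then h (n mod q) else 0) else 0)"
      using U by (simp add: sum.delta)
    also have "\<dots> = (if coprime n q then h n else 0)"
      using q h[of "n mod q" n] by (auto simp: U_def cong_def)
    finally show ?thesis ..
  qed
  have "summable (\<lambda>n. \<Sum>r\<in>U. h r / d * (\<Sum>\<psi>\<in>?D. \<psi> (b r) * (of_int (moebius_mu n) * \<psi> n / of_nat n)))"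
    using moebius_char_sums[OF _ q] by (intro summable_sum summable_mult) (auto dest: sums_summable)
  also have "(\<lambda>n. \<Sum>r\<in>U. h r / d * (\<Sum>\<psi>\<in>?D. \<psi> (b r) * (of_int (moebius_mu n) * \<psi> n / of_nat n)))
      = (\<lambda>n. of_int (moebius_mu n) * (if coprime n q then h n else 0) / of_nat n)"
    unfolding expand by (simp add: sum_distrib_left sum_divide_distrib sum_distrib_right mult_ac)
  finally show ?thesis .
qed

section \<open>Values at roots of unity\<close>

lemma strict_mono_times_nat: "d > 0 \<Longrightarrow> strict_mono ((*) (d :: nat))"
  by (auto simp: strict_mono_def)

lemma moebius_mu_mult:
  "moebius_mu (d * n) = (if coprime n d then moebius_mu d * moebius_mu n else 0)"
  using moebius_mu_mult_coprime[of d n] moebius_mu_mult_not_coprime[of d n] by (auto simp: coprime_commute)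

lemma summable_moebius_periodic:
  fixes h :: "nat \<Rightarrow> complex"
  assumes m: "m > 0" and h: "\<And>j k. [j = k] (mod m) \<Longrightarrow> h j = h k"
  shows "summable (\<lambda>n. of_int (moebius_mu n) * h n / of_nat n)"
proof -
  define f where "f d n = (if gcd n m = d then of_int (moebius_mu n) * h n / of_nat n else 0)" for d n
  have "summable (f d)" if d: "d dvd m" for d
  proof -
    have "d > 0" using d m by (auto intro: Nat.gr0I)
    obtain k where k: "m = d * k" using d by auto
    \<comment> \<open>With \<open>m = d * k\<close> the gcd condition means \<open>n\<close> coprime
      to \<open>k\<close>, and \<open>moebius_mu (d * n)\<close> vanishes unless \<open>n\<close> is
      coprime to \<open>d\<close>; together this is coprimality to \<open>m\<close>.\<close>
    have "f d (d * n) = of_int (moebius_mu d) / of_nat d *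
        (of_int (moebius_mu n) * (if coprime n m then h (d * n) else 0) / of_nat n)" for n
    proof -
      have "gcd (d * n) m = d * gcd n k" unfolding k by (rule gcd_mult_distrib_nat[symmetric])
      then have "gcd (d * n) m = d \<longleftrightarrow> gcd n k = 1" using \<open>d > 0\<close> by auto
      then have "gcd (d * n) m = d \<longleftrightarrow> coprime n k" by (simp only: coprime_iff_gcd_eq_1)
      moreover have "coprime n m \<longleftrightarrow> coprime n d \<and> coprime n k" by (simp add: k)
      ultimately show ?thesis by (auto simp: f_def moebius_mu_mult)
    qed
    moreover have "summable (\<lambda>n. of_int (moebius_mu n) * (if coprime n m then h (d * n) else 0) / of_nat n)"
      by (rule summable_moebius_coprime_periodic[OF m], rule h, rule cong_mult[OF cong_refl])
    ultimately have "summable (\<lambda>n. f d (d * n))" by (simp only: summable_mult)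
    moreover have "f d n = 0" if "n \<notin> range ((*) d)" for n
    proof -
      have "\<not> d dvd n" using that by (auto elim: dvdE)
      then have "gcd n m \<noteq> d" using gcd_dvd1 by metis
      then show ?thesis by (simp add: f_def)
    qed
    ultimately show "summable (f d)"
      using summable_mono_reindex[OF strict_mono_times_nat[OF \<open>d > 0\<close>], of "f d"] by simp
  qed
  then have "summable (\<lambda>n. \<Sum>d | d dvd m. f d n)" by (intro summable_sum) auto
  moreover have "(\<Sum>d | d dvd m. f d n) = of_int (moebius_mu n) * h n / of_nat n" for n
    using m by (simp add: f_def sum.delta)
  ultimately show ?thesis by simp
qed

lemma moebius_multiples_sums_0:
  assumes "e > 0"
  shows "(\<lambda>n. if e dvd n then of_int (moebius_mu n) / of_nat n else 0) sums (0 :: complex)"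
proof -
  let ?f = "\<lambda>n. if e dvd n then of_int (moebius_mu n) / of_nat n else (0 :: complex)"
  have eq: "?f (e * n) = of_int (moebius_mu e) / of_nat e * (of_int (moebius_mu n) * (if coprime n e then 1 else 0) / of_nat n)" for n
    by (simp add: moebius_mu_mult)
  have "(\<lambda>n. ?f (e * n)) sums 0"
    using sums_mult[OF moebius_coprime_sums_0[OF assms], of "of_int (moebius_mu e) / of_nat e"]
    by (simp only: eq mult_zero_right)
  moreover have "?f n = 0" if "n \<notin> range ((*) e)" for n using that by (auto simp: dvd_def image_def)
  ultimately show ?thesis
    using sums_mono_reindex[OF strict_mono_times_nat[OF assms], of ?f] by blast
qed

lemma M1_root_of_unity_sums:
  assumes "m > 0" "z ^ m = 1"
  shows "(\<lambda>n. of_int (moebius_mu n) * z ^ n / of_nat n) sums M1 z"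
proof -
  have "z ^ j = z ^ (j mod m)" for j
  proof -
    have "z ^ j = z ^ (m * (j div m) + j mod m)" by simp
    then show ?thesis using assms(2) unfolding power_add power_mult by simp
  qed
  then have "z ^ j = z ^ k" if "[j = k] (mod m)" for j k
    using that unfolding cong_def by metis
  then have "summable (\<lambda>n. of_int (moebius_mu n) * z ^ n / of_nat n)"
    by (rule summable_moebius_periodic[OF assms(1)])
  \<comment> \<open>The term at 0 is 0 because division by 0 gives 0, so the index shift in
    \<open>pseries\<close> changes nothing.\<close>
  then have "(\<lambda>n. of_int (moebius_mu (Suc n)) * z ^ Suc n / of_nat (Suc n)) sums
      ((\<Sum>n. of_int (moebius_mu n) * z ^ n / of_nat n) - of_int (moebius_mu 0) * z ^ 0 / of_nat 0)"
    by (subst sums_Suc_iff) (simp add: summable_sums)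
  then have "M1 z = (\<Sum>n. of_int (moebius_mu n) * z ^ n / of_nat n)"
    unfolding M1_def pseries_def M1_coeff_def by (simp add: sums_iff)
  then show ?thesis using \<open>summable _\<close> by (simp add: summable_sums)
qed

lemma sum_roots_of_unity_power:
  assumes "m > 0"
  shows "(\<Sum>h=1..m. exp (2 * \<i> * of_real pi * of_nat h / of_nat m) ^ j) = (if m dvd j then of_nat m else 0)"
proof -
  define z where "z = exp (2 * of_real pi * \<i> * of_nat j / of_nat m)"
  have "exp (2 * \<i> * of_real pi * of_nat h / of_nat m) ^ j = z ^ h" for h
    by (simp add: z_def mult_ac flip: exp_of_nat_mult)
  then have eq: "(\<Sum>h=1..m. exp (2 * \<i> * of_real pi * of_nat h / of_nat m) ^ j) = (\<Sum>h=1..m. z ^ h)" by simp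
  have z1: "z = 1 \<longleftrightarrow> m dvd j"
    unfolding z_def using assms complex_root_unity_eq_1[of m j] by simp
  have zm: "z ^ m = 1" unfolding z_def using assms by (intro complex_root_unity) auto
  show ?thesis
  proof (cases "m dvd j")
    case False
    have "(\<Sum>h=1..m. z ^ h) = (\<Sum>h<m. z ^ Suc h)"
      by (rule sum.reindex_bij_witness[of _ Suc "\<lambda>h. h - 1"]) auto
    also have "\<dots> = z * (\<Sum>h<m. z ^ h)" by (simp add: sum_distrib_left)
    also have "(\<Sum>h<m. z ^ h) = 0" using False z1 zm by (simp add: geometric_sum)
    finally show ?thesis using False eq by simp
  qed (use eq z1 in simp)
qed

lemma sum_M1_roots_of_unity:
  assumes "m > 0" "k > 0"
  shows "(\<Sum>h=1..m. M1 (exp (2 * \<i> * of_real pi * of_nat h / of_nat m) ^ k)) = 0"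
proof -
  define \<omega> where "\<omega> h = exp (2 * \<i> * of_real pi * of_nat h / of_nat m)" for h
  define e where "e = m div gcd m k"
  have e: "e > 0" using assms by (simp add: e_def div_greater_zero_iff)
  have "(\<omega> h ^ k) ^ m = 1" for h
  proof -
    have "\<omega> h ^ m = 1"
      using complex_root_unity[of m h] assms by (simp add: \<omega>_def mult_ac)
    then show ?thesis by (metis power_commutes power_mult mult.commute power_one)
  qed
  then have "(\<lambda>n. \<Sum>h=1..m. of_int (moebius_mu n) * (\<omega> h ^ k) ^ n / of_nat n) sums (\<Sum>h=1..m. M1 (\<omega> h ^ k))"
    using assms(1) by (intro sums_sum M1_root_of_unity_sums)
  moreover have "(\<Sum>h=1..m. of_int (moebius_mu n) * (\<omega> h ^ k) ^ n / of_nat n)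
      = of_nat m * (if e dvd n then of_int (moebius_mu n) / of_nat n else 0)" for n
  proof -
    have "(\<Sum>h=1..m. of_int (moebius_mu n) * (\<omega> h ^ k) ^ n / of_nat n)
        = of_int (moebius_mu n) / of_nat n * (\<Sum>h=1..m. \<omega> h ^ (k * n))"
      by (simp add: sum_distrib_left power_mult)
    also have "(\<Sum>h=1..m. \<omega> h ^ (k * n)) = (if m dvd k * n then of_nat m else 0)"
      unfolding \<omega>_def by (rule sum_roots_of_unity_power[OF assms(1)])
    \<comment> \<open>With the common factor \<open>g\<close> removed from \<open>m\<close> and
      \<open>k\<close>, the cofactors \<open>e\<close> and \<open>k'\<close> are coprime, so
      divisibility rests on \<open>n\<close> alone.\<close>
    also have "m dvd k * n \<longleftrightarrow> e dvd n"
    proof -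
      define g where "g = gcd m k"
      have "g > 0" using assms by (simp add: g_def)
      obtain k' where k': "k = g * k'" unfolding g_def using gcd_dvd2 dvd_def by blast
      have m: "m = g * e" by (simp add: e_def g_def)
      have "gcd (g * e) (g * k') = g * gcd e k'" by (rule gcd_mult_distrib_nat[symmetric])
      then have "g = g * gcd e k'" unfolding m[symmetric] k'[symmetric] g_def[symmetric] .
      then have "gcd e k' = 1" using \<open>g > 0\<close> by auto
      then have "coprime e k'" by (simp only: coprime_iff_gcd_eq_1)
      have "m dvd k * n \<longleftrightarrow> g * e dvd g * (k' * n)" by (simp add: m k' mult.assoc)
      also have "\<dots> \<longleftrightarrow> e dvd k' * n" using \<open>g > 0\<close> by simp
      also have "\<dots> \<longleftrightarrow> e dvd n" using \<open>coprime e k'\<close> by (rule coprime_dvd_mult_right_iff)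
      finally show ?thesis .
    qed
    finally show ?thesis by simp
  qed
  ultimately have "(\<lambda>n. of_nat m * (if e dvd n then of_int (moebius_mu n) / of_nat n else 0)) sums (\<Sum>h=1..m. M1 (\<omega> h ^ k))"
    by simp
  moreover have "(\<lambda>n. of_nat m * (if e dvd n then of_int (moebius_mu n) / of_nat n else 0)) sums (of_nat m * 0 :: complex)"
    by (intro sums_mult moebius_multiples_sums_0 e)
  ultimately show ?thesis unfolding \<omega>_def using sums_unique2 by fastforce
qed

theorem mainTheorem6:
  fixes a :: "nat \<Rightarrow> complex" and m :: nat
  assumes "summable (\<lambda>k. norm (a (Suc k)))"
    and "m \<ge> 1"
  shows "(\<Sum>h = 1..m. (a \<otimes>\<^sub>D M1_coeff) (exp (2 * \<i> * of_real pi * of_nat h / of_nat m))) = 0"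
proof -
  define \<omega> where "\<omega> h = exp (2 * \<i> * of_real pi * of_nat h / of_nat m)" for h
  have m: "m > 0" using assms(2) by simp
  \<comment> \<open>All arguments of \<open>M1\<close> are \<open>m\<close>-th roots of unity, a
    finite set, so the sum of the norms bounds each value. This majorises the series over
    \<open>k\<close> by \<open>B\<close> times the series of \<open>norm (a (Suc k))\<close> and
    justifies exchanging the sums.\<close>
  define B where "B = (\<Sum>z | z ^ m = 1. norm (M1 z))"
  have "finite {z::complex. z ^ m = 1}" using assms(2) by (rule finite_roots_unity)
  then have B: "norm (M1 z) \<le> B" if "z ^ m = 1" for z
    unfolding B_def using that by (intro member_le_sum) auto
  have root: "(\<omega> h ^ k) ^ m = 1" for h k
  proof -
    have "\<omega> h ^ m = 1"
      using complex_root_unity[of m h] m by (simp add: \<omega>_def mult_ac)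
    then show ?thesis by (metis power_mult mult.commute power_one)
  qed
  have summable: "summable (\<lambda>k. a (Suc k) * M1 (\<omega> h ^ Suc k))" for h
  proof (rule summable_comparison_test'[where N = 0])
    show "summable (\<lambda>k. norm (a (Suc k)) * B)" using assms(1) by (rule summable_mult2)
    show "norm (a (Suc k) * M1 (\<omega> h ^ Suc k)) \<le> norm (a (Suc k)) * B" for k
      unfolding norm_mult by (intro mult_left_mono B root) auto
  qed
  have "(\<Sum>h = 1..m. (a \<otimes>\<^sub>D M1_coeff) (\<omega> h)) = (\<Sum>h = 1..m. \<Sum>k. a (Suc k) * M1 (\<omega> h ^ Suc k))"
    by (simp only: dirichlet_prod_M1)
  also have "\<dots> = (\<Sum>k. \<Sum>h = 1..m. a (Suc k) * M1 (\<omega> h ^ Suc k))"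
    using summable by (rule suminf_sum[symmetric])
  also have "\<dots> = (\<Sum>k. a (Suc k) * (\<Sum>h = 1..m. M1 (\<omega> h ^ Suc k)))"
    by (simp only: sum_distrib_left)
  also have "\<dots> = 0"
    using sum_M1_roots_of_unity[OF m zero_less_Suc] by (simp only: \<omega>_def mult_zero_right suminf_zero)
  finally show ?thesis unfolding \<omega>_def .
qed

end
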